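(* Let $\delta\in(0,1)$ and $c=7(1+\delta)^{3/2}/(1-\delta)^{3/2}$. Let $\mathcal A:\mathbb R^{n_1\times n_2}\to\mathbb R^m$ be a linear map satisfying a $2r$-RIP with constant $\delta_{2r}\le\delta$. Let $b=\mathcal A(X^* )+\xi$, where $X^*\in\mathbb R^{n_1\times n_2}$ has rank $r$, $\sigma_r^*=\sigma_r(X^* )$, and $\xi\in\mathbb R^m$ satisfies $$\|\xi\|\le\frac{\sigma_r^*\sqrt{1-\delta}}{6c}.$$ Denote $\gamma=c/(4\sigma_r^* )$. Let $U_0'\in\mathbb R^{n_1\times r}$, $V_0'\in\mathbb R^{n_2\times r}$ be any matrices with $\|U_0'V_0'^\top-X^*\|_F\le\sigma_r^*/c$, let $(U_t,V_t)_{t\ge0}$ be the iterates of the updating variant of GNMR with SVD-balancing step started at $(U_0',V_0')$ (defined in the context), and let $X_t=U_tV_t^\top$. Then $$\|X_{t+1}-X^*\|_F\le\gamma\,\|X_t-X^*\|_F^2+\frac{3\|\xi\|}{\sqrt{1-\delta}}\qquad\text{for all } t=0,1,2,\ldots$$ As a result, for all $t\ge0$, $$\|X_t-X^*\|_F\le\frac{\sigma_r^*}{4^{2^t-1}\,c}+\frac{6\|\xi\|}{\sqrt{1-\delta}},$$ where the right-hand side tends to $6\|\xi\|/\sqrt{1-\delta}$ as $t\to\infty$.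
   Context: $\sigma_i(X)$ is the $i$-th largest singular value of $X$; $\|\cdot\|_F$ is the Frobenius norm and $\|\cdot\|$ the Euclidean norm. RIP: a linear map $\mathcal A:\mathbb R^{n_1\times n_2}\to\mathbb R^m$ satisfies a $k$-RIP with constant $\delta_k\in[0,1)$ if $(1-\delta_k)\|X\|_F^2\le\|\mathcal A(X)\|^2\le(1+\delta_k)\|X\|_F^2$ for all $X\in\mathbb R^{n_1\times n_2}$ of rank at most $k$. GNMR with SVD-balancing step, updating variant (data $\mathcal A,b$): for $t=0,1,2,\ldots$, given $(U_t',V_t')\in\mathbb R^{n_1\times r}\times\mathbb R^{n_2\times r}$: (1) let $U\Sigma V^\top$ be a rank-$r$ SVD of $U_t'V_t'^\top$ ($U\in\mathbb R^{n_1\times r}$ and $V\in\mathbb R^{n_2\times r}$ with orthonormal columns, $\Sigma\in\mathbb R^{r\times r}$ diagonal containing the top $r$ singular values), and set $U_t=U\Sigma^{1/2}$, $V_t=V\Sigma^{1/2}$ (so $U_tV_t^\top=U_t'V_t'^\top$); (2) let $(\Delta U_t,\Delta V_t)$ be the minimizer of $\|\mathcal A(U_tV_t^\top+U_t\Delta V^\top+\Delta U\,V_t^\top)-b\|^2$ over $\mathbb R^{n_1\times r}\times\mathbb R^{n_2\times r}$ with smallest $\|\Delta U\|_F^2+\|\Delta V\|_F^2$; (3) set $U_{t+1}'=U_t+\Delta U_t$, $V_{t+1}'=V_t+\Delta V_t$. *)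

theory Defs
  imports "HOL-Analysis.Analysis" "HOL-Library.Multiset"
begin

text \<open>
  A real m x n matrix has type \<^typ>\<open>real^'n^'m\<close>. The library norm on this type is
  the square root of the sum of the squares of all entries, i.e. the Frobenius norm; on
  \<^typ>\<open>real^'m\<close> it is the Euclidean norm.
\<close>

definition diag_matrix :: "real^'n \<Rightarrow> real^'n^'n" where
  "diag_matrix s = (\<chi> i j. if i = j then s $ i else 0)"

definition eigenspace :: "real^'n^'n \<Rightarrow> real \<Rightarrow> (real^'n) set" where
  "eigenspace G l = {v. G *v v = l *\<^sub>R v}"

definition eigenvalues :: "real^'n^'n \<Rightarrow> real set" where
  "eigenvalues G = {l. \<exists>v. v \<noteq> 0 \<and> G *v v = l *\<^sub>R v}"

text \<open>
  Singular values are the square roots of the eigenvalues of the Gram matrix, counted with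
  multiplicity (the dimension of the eigenspace; the Gram matrix is symmetric) and listed in
  decreasing order. The list has one entry per column of the matrix; if there are more columns
  than rows, the surplus entries are zeros at its end. Positions are counted from 1 in
  \<open>singular_value\<close>, which is meaningful only for positions from 1 to the number of columns.
\<close>

definition singular_values :: "real^'n^'m \<Rightarrow> real list" where
  "singular_values X =
     (let G = transpose X ** X in
      rev (sorted_list_of_multiset
        (\<Sum>l\<in>eigenvalues G. replicate_mset (dim (eigenspace G l)) (sqrt l))))"

definition singular_value :: "nat \<Rightarrow> real^'n^'m \<Rightarrow> real" where
  "singular_value i X = singular_values X ! (i - 1)"

definition RIP :: "nat \<Rightarrow> real \<Rightarrow> (real^'n2^'n1 \<Rightarrow> real^'m) \<Rightarrow> bool" where
  "RIP k \<delta> A \<longleftrightarrow> 0 \<le> \<delta> \<and> \<delta> < 1 \<and>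
     (\<forall>X. rank X \<le> k \<longrightarrow>
        (1 - \<delta>) * (norm X)\<^sup>2 \<le> (norm (A X))\<^sup>2 \<and> (norm (A X))\<^sup>2 \<le> (1 + \<delta>) * (norm X)\<^sup>2)"

text \<open>
  A rank-r SVD, r being the number of elements of \<^typ>\<open>'r\<close>, of a matrix \<open>M\<close> of rank at
  most r, for which the factorization is exact. The diagonal of the middle factor is \<open>s\<close>; as
  \<^typ>\<open>'r\<close> carries no order, \<open>p\<close> assigns to each diagonal position the index of its
  singular value.
\<close>

definition is_rank_svd ::
  "real^'n2^'n1 \<Rightarrow> real^'r^'n1 \<Rightarrow> real^'r \<Rightarrow> real^'r^'n2 \<Rightarrow> bool" where
  "is_rank_svd M P s Q \<longleftrightarrow>
     transpose P ** P = mat 1 \<and> transpose Q ** Q = mat 1 \<and>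
     (\<exists>p. bij_betw p (UNIV :: 'r set) {1..CARD('r)} \<and> (\<forall>k. s $ k = singular_value (p k) M)) \<and>
     M = P ** diag_matrix s ** transpose Q"

text \<open>
  The SVD is not unique, so the balancing step and the resulting iterations are relations.
\<close>

definition svd_balancing ::
  "real^'r^'n1 \<Rightarrow> real^'r^'n2 \<Rightarrow> real^'r^'n1 \<Rightarrow> real^'r^'n2 \<Rightarrow> bool" where
  "svd_balancing U' V' U V \<longleftrightarrow>
     (\<exists>P s Q. is_rank_svd (U' ** transpose V') P s Q \<and>
        U = P ** diag_matrix (\<chi> k. sqrt (s $ k)) \<and>
        V = Q ** diag_matrix (\<chi> k. sqrt (s $ k)))"

definition gnmr_objective ::
  "(real^'n2^'n1 \<Rightarrow> real^'m) \<Rightarrow> real^'m \<Rightarrow> real^'r^'n1 \<Rightarrow> real^'r^'n2 \<Rightarrow>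
   (real^'r^'n1) \<times> (real^'r^'n2) \<Rightarrow> real" where
  "gnmr_objective A b U V = (\<lambda>(dU, dV).
     (norm (A (U ** transpose V + U ** transpose dV + dU ** transpose V) - b))\<^sup>2)"

definition gnmr_direction ::
  "(real^'n2^'n1 \<Rightarrow> real^'m) \<Rightarrow> real^'m \<Rightarrow> real^'r^'n1 \<Rightarrow> real^'r^'n2 \<Rightarrow>
   real^'r^'n1 \<Rightarrow> real^'r^'n2 \<Rightarrow> bool" where
  "gnmr_direction A b U V dU dV \<longleftrightarrow>
     is_arg_min (\<lambda>(dU, dV). (norm dU)\<^sup>2 + (norm dV)\<^sup>2)
       (is_arg_min (gnmr_objective A b U V) (\<lambda>_. True)) (dU, dV)"

definition gnmr_updating_iterates ::
  "(real^'n2^'n1 \<Rightarrow> real^'m) \<Rightarrow> real^'m \<Rightarrow>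
   (nat \<Rightarrow> real^'r^'n1) \<Rightarrow> (nat \<Rightarrow> real^'r^'n2) \<Rightarrow>
   (nat \<Rightarrow> real^'r^'n1) \<Rightarrow> (nat \<Rightarrow> real^'r^'n2) \<Rightarrow> bool" where
  "gnmr_updating_iterates A b U' V' U V \<longleftrightarrow>
     (\<forall>t. svd_balancing (U' t) (V' t) (U t) (V t) \<and>
        (\<exists>dU dV. gnmr_direction A b (U t) (V t) dU dV \<and>
           U' (Suc t) = U t + dU \<and> V' (Suc t) = V t + dV))"

end

theory Submission
  imports Defs
begin

text \<open>
  Let \<open>T\<close> be the tangent space of the rank-r matrices at \<open>X\<^sub>t = P S Q\<^sup>T\<close>. It is the range of
  \<open>(\<Delta>U, \<Delta>V) \<mapsto> U \<Delta>V\<^sup>T + \<Delta>U V\<^sup>T\<close>, and as \<open>X\<^sub>t\<close> is close to \<open>X\<^sup>*\<close>, all entries of \<open>S\<close> are at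
  least \<open>6/7 \<sigma>\<close>, so that balanced factors \<open>U\<close>, \<open>V\<close> admit preimages \<open>(\<Delta>U, \<Delta>V)\<close> of squared norm at
  most \<open>\<parallel>N\<parallel>\<^sup>2 / (6/7 \<sigma>)\<close> for every \<open>N \<in> T\<close>. The projection \<open>Y\<close> of \<open>X\<^sup>*\<close> to \<open>T\<close> misses \<open>X\<^sup>*\<close> only by a
  quantity of order \<open>\<parallel>X\<^sub>t - X\<^sup>*\<parallel>\<^sup>2 / \<sigma>\<close>. The least-squares solution \<open>W\<close> in \<open>X\<^sub>t + T\<close> differs from
  \<open>Y\<close> by a matrix of rank at most \<open>2r\<close>, so the RIP bounds \<open>\<parallel>W - Y\<parallel>\<close> by the misfit of \<open>Y\<close>. The next
  iterate is \<open>W + \<Delta>U \<Delta>V\<^sup>T\<close>, whose last term is again quadratically small because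
  \<open>(\<Delta>U, \<Delta>V)\<close> has minimal norm.
\<close>

subsection \<open>The Frobenius inner product\<close>

lemma inner_matrix_entries:
  fixes A B :: "real^'n^'m"
  shows "A \<bullet> B = (\<Sum>i\<in>UNIV. \<Sum>j\<in>UNIV. A $ i $ j * B $ i $ j)"
  by (simp add: inner_vec_def)

lemma norm_matrix_square:
  fixes A :: "real^'n^'m"
  shows "(norm A)\<^sup>2 = (\<Sum>i\<in>UNIV. \<Sum>j\<in>UNIV. (A $ i $ j)\<^sup>2)"
  unfolding power2_norm_eq_inner inner_matrix_entries by (simp add: power2_eq_square)

lemma inner_transpose:
  fixes A B :: "real^'n^'m"
  shows "transpose A \<bullet> transpose B = A \<bullet> B"
  unfolding inner_matrix_entries transpose_def by simp (rule sum.swap)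

lemma norm_transpose:
  fixes A :: "real^'n^'m"
  shows "norm (transpose A) = norm A"
  by (simp add: norm_eq_sqrt_inner inner_transpose)

lemma inner_matrix_mult_right:
  fixes A :: "real^'k^'m" and B :: "real^'n^'k" and C :: "real^'n^'m"
  shows "(A ** B) \<bullet> C = A \<bullet> (C ** transpose B)"
proof -
  have "(A ** B) \<bullet> C = (\<Sum>i\<in>UNIV. \<Sum>j\<in>UNIV. \<Sum>k\<in>UNIV. A $ i $ k * B $ k $ j * C $ i $ j)"
    by (simp add: inner_matrix_entries matrix_matrix_mult_def sum_distrib_right)
  also have "\<dots> = (\<Sum>i\<in>UNIV. \<Sum>k\<in>UNIV. \<Sum>j\<in>UNIV. A $ i $ k * B $ k $ j * C $ i $ j)"
    by (intro sum.cong refl sum.swap)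
  also have "\<dots> = A \<bullet> (C ** transpose B)"
    by (simp add: inner_matrix_entries matrix_matrix_mult_def transpose_def sum_distrib_left ac_simps)
  finally show ?thesis .
qed

lemma norm_matrix_vector_mult_le:
  fixes A :: "real^'n^'m"
  shows "norm (A *v x) \<le> norm A * norm x"
proof -
  have "(norm (A *v x))\<^sup>2 = (\<Sum>i\<in>UNIV. (A $ i \<bullet> x)\<^sup>2)"
    by (simp only: power2_norm_eq_inner inner_vec_def[of "A *v x"])
      (simp add: matrix_vector_mult_def inner_vec_def power2_eq_square)
  also have "\<dots> \<le> (\<Sum>i\<in>UNIV. (norm (A $ i) * norm x)\<^sup>2)"
    by (intro sum_mono) (metis Cauchy_Schwarz_ineq2 abs_ge_zero power2_abs power_mono)
  also have "\<dots> = (norm A)\<^sup>2 * (norm x)\<^sup>2"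
    by (simp add: power_mult_distrib sum_distrib_right power2_norm_eq_inner[of A] inner_vec_def[of A]
        power2_norm_eq_inner[of "A $ _"])
  finally show ?thesis
    by (metis power_mult_distrib power2_le_imp_le mult_nonneg_nonneg norm_ge_zero)
qed

lemma norm_matrix_columns:
  fixes A :: "real^'n^'m"
  shows "(norm A)\<^sup>2 = (\<Sum>j\<in>UNIV. (norm (column j A))\<^sup>2)"
  unfolding norm_matrix_square
  by (subst sum.swap)
    (simp add: column_def inner_vec_def power2_norm_eq_inner, simp add: power2_eq_square)

text \<open>On standard basis vectors the hypothesis compares columns, and squared Frobenius norms
  add over columns. So pointwise estimates of matrix-vector products pass to Frobenius
  norms.\<close>

lemma norm_matrix_le_by_columns:
  fixes A :: "real^'n^'m" and B :: "real^'n^'k"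
  assumes "\<And>v. norm (A *v v) \<le> C * norm (B *v v)" and "C \<ge> 0"
  shows "norm A \<le> C * norm B"
proof -
  have "(norm A)\<^sup>2 \<le> (\<Sum>j\<in>UNIV. (C * norm (column j B))\<^sup>2)"
    unfolding norm_matrix_columns
    by (intro sum_mono power_mono) (use assms(1)[of "axis _ 1"] in \<open>simp_all add: matrix_vector_mul_component matrix_vector_mult_basis\<close>)
  also have "\<dots> = (C * norm B)\<^sup>2"
    by (simp add: power_mult_distrib norm_matrix_columns[of B] sum_distrib_left)
  finally show ?thesis
    using assms(2) by (meson power2_le_imp_le mult_nonneg_nonneg norm_ge_zero)
qed

lemma norm_matrix_mult_le:
  fixes A :: "real^'k^'m" and B :: "real^'n^'k"
  shows "norm (A ** B) \<le> norm A * norm B"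
  by (rule norm_matrix_le_by_columns)
    (simp_all add: matrix_vector_mul_assoc[symmetric] norm_matrix_vector_mult_le)

lemma matrix_diff_ldistrib:
  fixes A :: "real^'k^'m" and B C :: "real^'n^'k"
  shows "A ** (B - C) = A ** B - A ** C"
  by (simp add: matrix_matrix_mult_def vec_eq_iff right_diff_distrib sum_subtractf)

lemma matrix_diff_rdistrib:
  fixes A B :: "real^'k^'m" and C :: "real^'n^'k"
  shows "(A - B) ** C = A ** C - B ** C"
  by (simp add: matrix_matrix_mult_def vec_eq_iff left_diff_distrib sum_subtractf)

lemma matrix_add_rdistrib:
  fixes A B :: "real^'k^'m" and C :: "real^'n^'k"
  shows "(A + B) ** C = A ** C + B ** C"
  by (simp add: matrix_matrix_mult_def vec_eq_iff distrib_right sum.distrib)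

lemma transpose_diff:
  fixes A B :: "real^'n^'m"
  shows "transpose (A - B) = transpose A - transpose B"
  by (simp add: transpose_def vec_eq_iff)

text \<open>Pythagoras: \<open>R\<close> is an orthogonal projection, and in the Frobenius inner
  product it can be moved to the other factor, where \<open>(mat 1 - R) ** R = 0\<close>.\<close>

lemma norm_orthogonal_projection_right:
  fixes N :: "real^'n^'m" and R :: "real^'n^'n"
  assumes "transpose R = R" "R ** R = R"
  shows "(norm N)\<^sup>2 = (norm (N ** R))\<^sup>2 + (norm (N ** (mat 1 - R)))\<^sup>2"
proof -
  have "(N ** R) \<bullet> (N ** (mat 1 - R)) = 0"
    by (simp add: inner_matrix_mult_right[of N R] assms matrix_mul_assoc[symmetric]
        matrix_diff_rdistrib matrix_diff_ldistrib transpose_diff)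
  moreover have "N = N ** R + N ** (mat 1 - R)"
    by (simp add: matrix_add_ldistrib[symmetric])
  ultimately show ?thesis
    by (metis norm_add_Pythagorean orthogonal_def)
qed

lemma norm_orthogonal_projection_left:
  fixes N :: "real^'n^'m" and R :: "real^'m^'m"
  assumes "transpose R = R" "R ** R = R"
  shows "(norm N)\<^sup>2 = (norm (R ** N))\<^sup>2 + (norm ((mat 1 - R) ** N))\<^sup>2"
proof -
  have "(norm N)\<^sup>2 = (norm (transpose N))\<^sup>2" by (simp add: norm_transpose)
  also have "\<dots> = (norm (transpose (R ** N)))\<^sup>2 + (norm (transpose ((mat 1 - R) ** N)))\<^sup>2"
    using norm_orthogonal_projection_right[OF assms, of "transpose N"]
    by (simp add: matrix_transpose_mul transpose_diff assms(1) transpose_mat)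
  finally show ?thesis by (simp add: norm_transpose)
qed

subsection \<open>Spectral theorem and singular values\<close>

text \<open>First-order condition at an extremum without derivatives, for variations in both
  directions. The test value is \<open>t = a / D\<close> with \<open>D\<close> positive and above
  \<open>C\<close>.\<close>

lemma quadratic_dominates_linear:
  fixes a C :: real
  assumes "\<And>t. a * t \<le> C * t\<^sup>2"
  shows "a = 0"
proof (rule ccontr)
  assume "a \<noteq> 0"
  define D where "D = \<bar>C\<bar> + 1"
  have D: "D > 0" "C < D" by (auto simp: D_def)
  have "a * (a / D) \<le> C * (a / D)\<^sup>2" by (rule assms)
  also have "\<dots> < D * (a / D)\<^sup>2" using D \<open>a \<noteq> 0\<close> by (intro mult_strict_right_mono) auto
  also have "\<dots> = a * (a / D)" using D by (simp add: power2_eq_square)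
  finally show False by simp
qed

text \<open>A maximizer \<open>u\<close> of the Rayleigh quotient on the unit sphere of
  \<open>S\<close> is an eigenvector: moving \<open>u\<close> in a direction \<open>w\<close> of
  \<open>S\<close> orthogonal to it cannot increase the quotient, so
  \<open>w \<bullet> f u = 0\<close>.\<close>

lemma selfadjoint_eigenvector:
  fixes f :: "'a::euclidean_space \<Rightarrow> 'a"
  assumes f: "linear f" and sym: "\<And>x y. f x \<bullet> y = x \<bullet> f y"
    and S: "subspace S" "f ` S \<subseteq> S" and nz: "dim S \<noteq> 0"
  obtains u l where "u \<in> S" "norm u = 1" "f u = l *\<^sub>R u"
proof -
  define K where "K = S \<inter> sphere 0 1"
  have "\<not> S \<subseteq> {0}" using nz by (simp only: dim_eq_0 not_False_eq_True)
  then obtain w where w: "w \<in> S" "w \<noteq> 0" by auto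
  then have "(1 / norm w) *\<^sub>R w \<in> K" using S(1) by (simp add: K_def subspace_scale)
  then have "K \<noteq> {}" by auto
  moreover have "compact K" unfolding K_def
    using S(1) by (intro closed_Int_compact closed_subspace compact_sphere)
  moreover have "continuous_on K (\<lambda>x. x \<bullet> f x)"
    using f by (intro continuous_intros linear_continuous_on linear_conv_bounded_linear[THEN iffD1])
  ultimately obtain u where u: "u \<in> K" "\<And>y. y \<in> K \<Longrightarrow> y \<bullet> f y \<le> u \<bullet> f u"
    using continuous_attains_sup[of K "\<lambda>x. x \<bullet> f x"] by blast
  define l where "l = u \<bullet> f u"
  have uS: "u \<in> S" and u1: "norm u = 1" using u(1) by (auto simp: K_def)
  have uu: "u \<bullet> u = 1" using u1 by (simp add: norm_eq_1)
  have le: "x \<bullet> f x \<le> l * (x \<bullet> x)" if "x \<in> S" for x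
  proof (cases "x = 0")
    case False
    then have "(1 / norm x) *\<^sub>R x \<in> K" using that S(1) by (simp add: K_def subspace_scale)
    from u(2)[OF this] have "(x \<bullet> f x) / (norm x)\<^sup>2 \<le> l"
      by (simp add: l_def linear_scale[OF f] power2_eq_square divide_inverse mult_ac)
    then show ?thesis using False
      by (simp add: pos_divide_le_eq power2_norm_eq_inner)
  qed simp
  have perp: "w \<bullet> f u = 0" if w: "w \<in> S" "w \<bullet> u = 0" for w
  proof -
    have "2 * (w \<bullet> f u) = 0"
    proof (rule quadratic_dominates_linear[where C = "l * (w \<bullet> w) - w \<bullet> f w"])
      fix t :: real
      have "u + t *\<^sub>R w \<in> S" using uS w S(1) by (simp add: subspace_add subspace_scale)
      from le[OF this] have "l + 2 * t * (w \<bullet> f u) + t\<^sup>2 * (w \<bullet> f w) \<le> l * (1 + t\<^sup>2 * (w \<bullet> w))"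
        using w(2) uu sym[of u w]
        by (simp add: linear_add[OF f] linear_scale[OF f] inner_add_left inner_add_right l_def[symmetric]
            power2_eq_square inner_commute algebra_simps)
      then show "2 * (w \<bullet> f u) * t \<le> (l * (w \<bullet> w) - w \<bullet> f w) * t\<^sup>2"
        by (simp add: algebra_simps)
    qed
    then show ?thesis by simp
  qed
  \<comment> \<open>The part of \<open>f u\<close> orthogonal to \<open>u\<close>. It stays in
    \<open>S\<close> by invariance, so \<open>perp\<close> makes it orthogonal to
    \<open>f u\<close>, hence to itself.\<close>
  define w where "w = f u - l *\<^sub>R u"
  have "w \<in> S" using uS S by (auto simp: w_def subspace_diff subspace_scale)
  moreover have wu: "w \<bullet> u = 0" using uu by (simp add: w_def inner_diff_left l_def inner_commute[of u "f u"])
  ultimately have "w \<bullet> f u = 0" by (rule perp)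
  then have "w \<bullet> w = 0" using wu by (simp add: w_def inner_diff_right)
  then have "f u = l *\<^sub>R u" by (simp add: w_def)
  with that uS u1 show ?thesis by blast
qed

text \<open>Split off one unit eigenvector; self-adjointness keeps its orthogonal complement in
  \<open>S\<close> invariant, and the dimension drops. Writing the eigenvalue as
  \<open>b \<bullet> f b\<close> avoids a separate family of eigenvalues.\<close>

lemma selfadjoint_orthonormal_eigenbasis:
  fixes f :: "'a::euclidean_space \<Rightarrow> 'a"
  assumes f: "linear f" and sym: "\<And>x y. f x \<bullet> y = x \<bullet> f y"
    and S: "subspace S" "f ` S \<subseteq> S"
  shows "\<exists>B. B \<subseteq> S \<and> pairwise orthogonal B \<and> (\<forall>b\<in>B. norm b = 1) \<and> span B = S \<and>
           (\<forall>b\<in>B. f b = (b \<bullet> f b) *\<^sub>R b)"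
  using S
proof (induction "dim S" arbitrary: S rule: less_induct)
  case (less S)
  show ?case
  proof (cases "dim S = 0")
    case True
    then have "S = {0}" using subspace_0[OF less.prems(1)] by auto
    then show ?thesis by (intro exI[of _ "{}"]) auto
  next
    case False
    obtain u l where u: "u \<in> S" "norm u = 1" "f u = l *\<^sub>R u"
      using selfadjoint_eigenvector[OF f sym less.prems False] by blast
    define T where "T = {x \<in> S. x \<bullet> u = 0}"
    have uu: "u \<bullet> u = 1" using u(2) by (simp add: norm_eq_1)
    have T: "subspace T" using less.prems(1) unfolding T_def subspace_def by (auto simp: inner_add_left)
    have fT: "f ` T \<subseteq> T" using less.prems(2) u(3) sym unfolding T_def by auto
    have "u \<notin> T" using uu by (simp add: T_def)
    moreover have TS: "T \<subseteq> S" by (auto simp: T_def)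
    ultimately have "T \<subset> S" using u(1) by blast
    then have "dim T < dim S" using T less.prems(1) by (metis dim_psubset span_eq_iff)
    from less.hyps[OF this T fT] obtain B where B: "B \<subseteq> T" "pairwise orthogonal B"
      "\<forall>b\<in>B. norm b = 1" "span B = T" "\<forall>b\<in>B. f b = (b \<bullet> f b) *\<^sub>R b" by blast
    have "span (insert u B) = S"
    proof
      show "span (insert u B) \<subseteq> S" using B(1) u(1) less.prems(1)
        by (intro span_minimal) (auto simp: T_def)
      show "S \<subseteq> span (insert u B)"
      proof
        fix x assume "x \<in> S"
        then have "x - (x \<bullet> u) *\<^sub>R u \<in> T" using u(1) uu less.prems(1)
          by (simp add: T_def subspace_diff subspace_scale inner_diff_left)
        then show "x \<in> span (insert u B)" using B(4) by (auto simp: span_insert)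
      qed
    qed
    moreover have "pairwise orthogonal (insert u B)"
      using B(1,2) by (auto simp: pairwise_insert T_def orthogonal_def inner_commute)
    moreover have "f u = (u \<bullet> f u) *\<^sub>R u" using u(3) uu by simp
    moreover have "insert u B \<subseteq> S" using B(1) TS u(1) by blast
    ultimately show ?thesis using B(3,5) u(2) by blast
  qed
qed

text \<open>Passes from distinct eigenvalues counted with multiplicity, as in
  \<open>singular_values\<close>, to one value per basis vector.\<close>

lemma sum_replicate_mset_image:
  fixes h :: "'a \<Rightarrow> 'b" and g :: "'b \<Rightarrow> 'c"
  assumes "finite B"
  shows "(\<Sum>l\<in>h ` B. replicate_mset (card {b\<in>B. h b = l}) (g l)) = (\<Sum>b\<in>B. {#g (h b)#})"
proof -
  have rep: "(\<Sum>b\<in>T. {#c#}) = replicate_mset (card T) c" if "finite T" for T :: "'a set" and c :: 'c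
    using that by induction auto
  have "(\<Sum>b\<in>B. {#g (h b)#}) = (\<Sum>l\<in>h ` B. \<Sum>b\<in>{b\<in>B. h b = l}. {#g (h b)#})"
    by (rule sum.image_gen[OF assms])
  also have "\<dots> = (\<Sum>l\<in>h ` B. \<Sum>b\<in>{b\<in>B. h b = l}. {#g l#})"
    by (intro sum.cong) auto
  also have "\<dots> = (\<Sum>l\<in>h ` B. replicate_mset (card {b\<in>B. h b = l}) (g l))"
    using assms by (intro sum.cong refl rep) auto
  finally show ?thesis by simp
qed

text \<open>The difference of both sides lies in the span and, by Gram-Schmidt, is orthogonal to it,
  hence zero.\<close>

lemma orthonormal_expansion:
  fixes B :: "'a::euclidean_space set"
  assumes "pairwise orthogonal B" "\<And>b. b \<in> B \<Longrightarrow> norm b = 1" "x \<in> span B"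
  shows "x = (\<Sum>b\<in>B. (x \<bullet> b) *\<^sub>R b)"
proof -
  have "(\<Sum>b\<in>B. (b \<bullet> x / (b \<bullet> b)) *\<^sub>R b) = (\<Sum>b\<in>B. (x \<bullet> b) *\<^sub>R b)"
    using assms(2) by (intro sum.cong refl) (simp add: norm_eq_1 inner_commute)
  then have "orthogonal (x - (\<Sum>b\<in>B. (x \<bullet> b) *\<^sub>R b)) y" if "y \<in> span B" for y
    using Gram_Schmidt_step[OF assms(1) that, of x] by (simp add: orthogonal_commute)
  moreover have "x - (\<Sum>b\<in>B. (x \<bullet> b) *\<^sub>R b) \<in> span B"
    by (intro span_diff span_sum span_scale span_base assms(3))
  ultimately show ?thesis by (metis orthogonal_self right_minus_eq)
qed

section \<open>Singular values as lengths of the images of right singular vectors\<close>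

lemma sum_single_eq_image_mset: "(\<Sum>b\<in>B. {#h b#}) = image_mset h (mset_set B)"
  by (induction B rule: infinite_finite_induct) auto

lemma inner_transpose_matrix_vector:
  fixes X :: "real^'n^'m"
  shows "(transpose X *v z) \<bullet> y = z \<bullet> (X *v y)"
  by (simp add: dot_lmul_matrix)

lemma gram_selfadjoint:
  fixes X :: "real^'n^'m"
  shows "((transpose X ** X) *v x) \<bullet> y = (X *v x) \<bullet> (X *v y)"
    and "x \<bullet> ((transpose X ** X) *v y) = (X *v x) \<bullet> (X *v y)"
  unfolding inner_commute[of x]
  by (simp_all only: matrix_vector_mul_assoc[symmetric] inner_transpose_matrix_vector)
    (simp add: inner_commute)

text \<open>Locates the positive singular values as an initial segment of the list, so that the one
  at position \<open>rank X\<close> is the least positive one.\<close>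

lemma filter_pos_descending:
  fixes xs :: "real list"
  assumes "sorted_wrt (\<ge>) xs"
  shows "filter (\<lambda>x. x > 0) xs = take (length (filter (\<lambda>x. x > 0) xs)) xs"
  using assms
proof (induction xs)
  case (Cons x xs)
  show ?case
  proof (cases "x > 0")
    case False
    then have "filter (\<lambda>x. x > 0) xs = []" using Cons.prems by (force simp: filter_empty_conv)
    then show ?thesis using False by simp
  qed (use Cons in auto)
qed simp

text \<open>The basis vectors are right singular vectors: an orthonormal eigenbasis of the Gram
  matrix, with eigenvalue \<open>(norm (X *v b))\<^sup>2\<close> at \<open>b\<close>. Later facts
  about singular values start from this basis.\<close>

lemma singular_value_eigenbasis:
  fixes X :: "real^'n^'m"
  shows "\<exists>B. pairwise orthogonal B \<and> (\<forall>b\<in>B. norm b = 1) \<and> span B = UNIV \<and>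
    (\<forall>b\<in>B. \<forall>b'\<in>B. b \<noteq> b' \<longrightarrow> (X *v b) \<bullet> (X *v b') = 0) \<and>
    mset (singular_values X) = image_mset (\<lambda>b. norm (X *v b)) (mset_set B)"
proof -
  define G where "G = transpose X ** X"
  have "\<exists>B. B \<subseteq> UNIV \<and> pairwise orthogonal B \<and> (\<forall>b\<in>B. norm b = 1) \<and> span B = UNIV \<and>
           (\<forall>b\<in>B. G *v b = (b \<bullet> (G *v b)) *\<^sub>R b)"
    by (rule selfadjoint_orthonormal_eigenbasis) (auto simp: G_def gram_selfadjoint)
  then obtain B where B: "pairwise orthogonal B" "\<And>b. b \<in> B \<Longrightarrow> norm b = 1" "span B = UNIV"
    "\<And>b. b \<in> B \<Longrightarrow> G *v b = (b \<bullet> (G *v b)) *\<^sub>R b" by blast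
  define lam where "lam b = b \<bullet> (G *v b)" for b
  have Gb: "G *v b = lam b *\<^sub>R b" if "b \<in> B" for b using B(4)[OF that] by (simp add: lam_def)
  have lam: "lam b = (norm (X *v b))\<^sup>2" for b
    by (simp add: lam_def G_def gram_selfadjoint power2_norm_eq_inner)
  have "0 \<notin> B" using B(2) by force
  then have indep: "independent B" using B(1) by (intro pairwise_orthogonal_independent)
  then have fin: "finite B" by (rule independent_imp_finite)
  \<comment> \<open>By self-adjointness an eigenvector for \<open>l\<close> is orthogonal to all
    basis vectors with another eigenvalue. Hence the multiplicity of \<open>l\<close> is the number
    of basis vectors with eigenvalue \<open>l\<close>.\<close>
  have espace: "eigenspace G l = span {b \<in> B. lam b = l}" for l
  proof
    show "span {b \<in> B. lam b = l} \<subseteq> eigenspace G l"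
    proof (rule span_minimal)
      show "subspace (eigenspace G l)"
        unfolding eigenspace_def subspace_def
        by (auto simp: matrix_vector_right_distrib scaleR_add_right matrix_vector_mult_scaleR)
    qed (auto simp: eigenspace_def Gb)
    show "eigenspace G l \<subseteq> span {b \<in> B. lam b = l}"
    proof
      fix x assume "x \<in> eigenspace G l"
      then have x: "G *v x = l *\<^sub>R x" by (simp add: eigenspace_def)
      have zero: "x \<bullet> b = 0" if "b \<in> B" "lam b \<noteq> l" for b
      proof -
        have "l * (x \<bullet> b) = (G *v x) \<bullet> b" by (simp add: x)
        also have "\<dots> = x \<bullet> (G *v b)" by (simp add: G_def gram_selfadjoint)
        also have "\<dots> = lam b * (x \<bullet> b)" by (simp add: Gb that)
        finally show ?thesis using that by simp
      qed
      have "x = (\<Sum>b\<in>B. (x \<bullet> b) *\<^sub>R b)"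
        using B(1-3) by (intro orthonormal_expansion) auto
      also have "\<dots> = (\<Sum>b | b \<in> B \<and> lam b = l. (x \<bullet> b) *\<^sub>R b)"
        using fin zero by (intro sum.mono_neutral_right) auto
      also have "\<dots> \<in> span {b \<in> B. lam b = l}"
        by (intro span_sum span_scale span_base)
      finally show "x \<in> span {b \<in> B. lam b = l}" .
    qed
  qed
  have dim: "dim (eigenspace G l) = card {b \<in> B. lam b = l}" for l
    unfolding espace dim_span
    by (intro dim_eq_card_independent independent_mono[OF indep]) auto
  have evs: "eigenvalues G = lam ` B"
  proof
    show "lam ` B \<subseteq> eigenvalues G"
    proof
      fix l assume "l \<in> lam ` B"
      then obtain b where b: "b \<in> B" "l = lam b" by blast
      then have "b \<noteq> 0" using \<open>0 \<notin> B\<close> by metis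
      with b Gb[of b] show "l \<in> eigenvalues G" unfolding eigenvalues_def by blast
    qed
    show "eigenvalues G \<subseteq> lam ` B"
    proof
      fix l assume "l \<in> eigenvalues G"
      then obtain v where v: "v \<noteq> 0" "v \<in> eigenspace G l"
        unfolding eigenvalues_def eigenspace_def by blast
      then have "{b \<in> B. lam b = l} \<noteq> {}" unfolding espace by force
      then show "l \<in> lam ` B" by blast
    qed
  qed
  have "mset (singular_values X) = (\<Sum>b\<in>B. {#sqrt (lam b)#})"
    unfolding singular_values_def Let_def G_def[symmetric] evs dim
    by (simp add: sum_replicate_mset_image[OF fin])
  then have mset: "mset (singular_values X) = image_mset (\<lambda>b. norm (X *v b)) (mset_set B)"
    by (simp add: sum_single_eq_image_mset lam)
  have orth: "(X *v b) \<bullet> (X *v b') = 0" if "b \<in> B" "b' \<in> B" "b \<noteq> b'" for b b'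
  proof -
    have "(X *v b) \<bullet> (X *v b') = (G *v b) \<bullet> b'" by (simp add: G_def gram_selfadjoint)
    also have "\<dots> = 0" using B(1) that by (auto simp: Gb pairwise_def orthogonal_def)
    finally show ?thesis .
  qed
  show ?thesis using B(1-3) orth mset by (intro exI[of _ B]) simp
qed

text \<open>The bounds on \<open>i\<close> keep the position inside the list, whose length is the
  size of an orthonormal basis; the entry is then the norm of an image vector.\<close>

lemma singular_value_nonneg:
  fixes X :: "real^'n^'m"
  assumes "1 \<le> i" "i \<le> CARD('n)"
  shows "singular_value i X \<ge> 0"
proof -
  obtain B :: "(real^'n) set" where B: "pairwise orthogonal B" "\<And>b. b \<in> B \<Longrightarrow> norm b = 1"
    "span B = UNIV"
    "\<And>b b'. b \<in> B \<Longrightarrow> b' \<in> B \<Longrightarrow> b \<noteq> b' \<Longrightarrow> (X *v b) \<bullet> (X *v b') = 0"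
    "mset (singular_values X) = image_mset (\<lambda>b. norm (X *v b)) (mset_set B)"
    using singular_value_eigenbasis[of X] by blast
  have "0 \<notin> B" using B(2) by force
  then have indep: "independent B" using B(1) by (intro pairwise_orthogonal_independent)
  have "length (singular_values X) = card B"
    using arg_cong[OF B(5), of size] by simp
  also have "\<dots> = CARD('n)"
    using dim_eq_card_independent[OF indep] B(3) by (metis dim_span dim_UNIV DIM_cart DIM_real mult_1_right)
  finally have "singular_values X ! (i - 1) \<in> set (singular_values X)"
    using assms by (intro nth_mem) simp
  also have "\<dots> = (\<lambda>b. norm (X *v b)) ` B"
    using arg_cong[OF B(5), of set_mset] independent_imp_finite[OF indep] by simp
  finally show ?thesis by (auto simp: singular_value_def)
qed

text \<open>\<open>R\<close> is the row space, spanned by the right singular vectors with nonzero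
  image. Their images are orthogonal and span the range, so there are \<open>r\<close> of them and
  the \<open>r\<close>-th singular value is the smallest positive one. The other basis vectors are
  annihilated, so \<open>R\<close> alone yields all values of \<open>X\<close>.\<close>

lemma singular_value_rank:
  fixes X :: "real^'n^'m"
  assumes r: "rank X = r" "r \<ge> 1"
  obtains R where "subspace R" "dim R = r" "singular_value r X > 0"
    "\<And>v. v \<in> R \<Longrightarrow> singular_value r X * norm v \<le> norm (X *v v)"
    "\<And>v. \<exists>h\<in>R. X *v h = X *v v"
proof -
  define \<sigma> where "\<sigma> = singular_value r X"
  obtain B :: "(real^'n) set" where B: "pairwise orthogonal B" "\<And>b. b \<in> B \<Longrightarrow> norm b = 1"
    "span B = UNIV"
    "\<And>b b'. b \<in> B \<Longrightarrow> b' \<in> B \<Longrightarrow> b \<noteq> b' \<Longrightarrow> (X *v b) \<bullet> (X *v b') = 0"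
    "mset (singular_values X) = image_mset (\<lambda>b. norm (X *v b)) (mset_set B)"
    using singular_value_eigenbasis[of X] by blast
  have "0 \<notin> B" using B(2) by force
  then have indep: "independent B" using B(1) by (intro pairwise_orthogonal_independent)
  then have fin: "finite B" by (rule independent_imp_finite)
  define P where "P = {b \<in> B. X *v b \<noteq> 0}"
  have P: "P \<subseteq> B" "finite P" using fin by (auto simp: P_def)
  have expand: "v = (\<Sum>b\<in>B. (v \<bullet> b) *\<^sub>R b)" for v
    using B(1-3) by (intro orthonormal_expansion) auto
  have X_expand: "X *v v = (\<Sum>b\<in>P. (v \<bullet> b) *\<^sub>R (X *v b))" for v
  proof -
    have "X *v v = (\<Sum>b\<in>B. (v \<bullet> b) *\<^sub>R (X *v b))"
      using arg_cong[OF expand[of v], of "(*v) X"]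
      by (simp only: linear_sum[OF matrix_vector_mul_linear] matrix_vector_mult_scaleR)
    also have "\<dots> = (\<Sum>b\<in>P. (v \<bullet> b) *\<^sub>R (X *v b))"
      using fin by (intro sum.mono_neutral_right) (auto simp: P_def)
    finally show ?thesis .
  qed
  have inj: "inj_on ((*v) X) P"
  proof (rule inj_onI, rule ccontr)
    fix x y assume "x \<in> P" "y \<in> P" "X *v x = X *v y" "x \<noteq> y"
    then show False using B(4)[of x y] by (simp add: P_def)
  qed
  have "range ((*v) X) \<subseteq> span ((*v) X ` P)"
  proof
    fix y assume "y \<in> range ((*v) X)"
    then obtain v where "y = X *v v" by blast
    then have y: "y = (\<Sum>b\<in>P. (v \<bullet> b) *\<^sub>R (X *v b))" using X_expand[of v] by (rule trans)
    show "y \<in> span ((*v) X ` P)" unfolding y by (intro span_sum span_scale span_base imageI)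
  qed
  then have "span (range ((*v) X)) = span ((*v) X ` P)"
    by (intro subset_antisym span_mono span_minimal) auto
  moreover have "independent ((*v) X ` P)"
    by (rule pairwise_orthogonal_independent)
      (auto simp: pairwise_def orthogonal_def P_def intro!: B(4))
  ultimately have cardP: "card P = r"
    using r(1) by (metis rank_dim_range dim_span dim_eq_card_independent card_image inj)
  define xs where "xs = singular_values X"
  have desc: "sorted_wrt (\<ge>) xs"
    unfolding xs_def singular_values_def Let_def by (simp add: sorted_wrt_rev)
  have "mset (filter (\<lambda>x. x > 0) xs) = filter_mset (\<lambda>x. x > 0) (image_mset (\<lambda>b. norm (X *v b)) (mset_set B))"
    by (simp add: xs_def B(5))
  also have "\<dots> = image_mset (\<lambda>b. norm (X *v b)) (mset_set P)"
    by (simp add: filter_mset_image_mset P_def filter_mset_mset_set fin)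
  finally have mP: "mset (filter (\<lambda>x. x > 0) xs) = image_mset (\<lambda>b. norm (X *v b)) (mset_set P)" .
  then have len: "length (filter (\<lambda>x. x > 0) xs) = r"
    using cardP by (metis size_image_mset size_mset size_mset_set)
  then have take: "filter (\<lambda>x. x > 0) xs = take r xs"
    using filter_pos_descending[OF desc] by simp
  have lenxs: "r \<le> length xs" using len length_filter_le by metis
  \<comment> \<open>Positions count from 1, so this is the last of the \<open>r\<close> positive
    entries.\<close>
  have "\<sigma> = take r xs ! (r - 1)" using r(2) by (simp add: \<sigma>_def singular_value_def xs_def)
  also have "\<dots> \<in> set (take r xs)" using r(2) lenxs by (intro nth_mem) simp
  finally have pos: "\<sigma> > 0" unfolding take[symmetric] by simp
  have lower: "\<sigma> \<le> norm (X *v b)" if "b \<in> P" for b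
  proof -
    have "norm (X *v b) \<in> set (take r xs)"
      using that arg_cong[OF mP, of set_mset] P(2) by (simp add: take)
    then obtain i where i: "i < r" "norm (X *v b) = xs ! i"
      by (auto simp: in_set_conv_nth)
    show ?thesis
    proof (cases "i = r - 1")
      case False
      then show ?thesis using desc i lenxs
        by (simp add: \<sigma>_def singular_value_def xs_def[symmetric] sorted_wrt_iff_nth_less)
    qed (simp add: i \<sigma>_def singular_value_def xs_def)
  qed
  show ?thesis
  proof
    show "subspace (span P)" by simp
    show "dim (span P) = r"
      using cardP dim_eq_card_independent[OF independent_mono[OF indep P(1)]] by simp
    show "singular_value r X > 0" using pos by (simp add: \<sigma>_def)
    fix v
    show "\<exists>h\<in>span P. X *v h = X *v v"
    proof
      show "(\<Sum>b\<in>P. (v \<bullet> b) *\<^sub>R b) \<in> span P" by (intro span_sum span_scale span_base)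
      show "X *v (\<Sum>b\<in>P. (v \<bullet> b) *\<^sub>R b) = X *v v"
        unfolding X_expand[of v]
        by (simp add: linear_sum[OF matrix_vector_mul_linear] matrix_vector_mult_scaleR)
    qed
    assume v: "v \<in> span P"
    have vP: "v = (\<Sum>b\<in>P. (v \<bullet> b) *\<^sub>R b)"
      using B(1,2) v P(1) by (intro orthonormal_expansion) (auto intro: pairwise_subset)
    \<comment> \<open>Pythagoras for the orthonormal vectors, then for their orthogonal images, each
      of length at least \<open>\<sigma>\<close>.\<close>
    have "(\<sigma> * norm v)\<^sup>2 = \<sigma>\<^sup>2 * (norm (\<Sum>b\<in>P. (v \<bullet> b) *\<^sub>R b))\<^sup>2"
      by (simp add: power_mult_distrib vP[symmetric])
    also have "(norm (\<Sum>b\<in>P. (v \<bullet> b) *\<^sub>R b))\<^sup>2 = (\<Sum>b\<in>P. (norm ((v \<bullet> b) *\<^sub>R b))\<^sup>2)"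
      using P(2) B(1) P(1)
      by (intro norm_sum_Pythagorean) (auto simp: pairwise_def orthogonal_def)
    also have "\<sigma>\<^sup>2 * \<dots> = (\<Sum>b\<in>P. (v \<bullet> b)\<^sup>2 * \<sigma>\<^sup>2)"
      using B(2) P(1) by (auto simp: sum_distrib_left mult_ac power_mult_distrib intro!: sum.cong)
    also have "\<dots> \<le> (\<Sum>b\<in>P. (v \<bullet> b)\<^sup>2 * (norm (X *v b))\<^sup>2)"
      using lower pos by (intro sum_mono mult_left_mono power_mono) auto
    also have "\<dots> = (\<Sum>b\<in>P. (norm ((v \<bullet> b) *\<^sub>R (X *v b)))\<^sup>2)"
      by (simp add: power_mult_distrib)
    also have "\<dots> = (norm (\<Sum>b\<in>P. (v \<bullet> b) *\<^sub>R (X *v b)))\<^sup>2"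
      using P(2) B(4) P(1)
      by (intro norm_sum_Pythagorean[symmetric]) (auto simp: pairwise_def orthogonal_def)
    also have "\<dots> = (norm (X *v v))\<^sup>2" by (simp only: X_expand[of v])
    finally show "singular_value r X * norm v \<le> norm (X *v v)"
      unfolding \<sigma>_def[symmetric] by (rule power2_le_imp_le) simp
  qed
qed

subsection \<open>Projection to the tangent space\<close>

lemma matrix_mult_diag_matrix:
  fixes A :: "real^'n^'m"
  shows "(A ** diag_matrix s) $ i $ k = A $ i $ k * s $ k"
  by (simp add: matrix_matrix_mult_def diag_matrix_def if_distrib cong: if_cong)

lemma diag_matrix_mult:
  fixes s t :: "real^'n"
  shows "diag_matrix s ** diag_matrix t = diag_matrix (\<chi> k. s $ k * t $ k)"
  by (simp add: vec_eq_iff matrix_mult_diag_matrix) (simp add: diag_matrix_def)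

lemma transpose_diag_matrix: "transpose (diag_matrix s) = diag_matrix s"
  by (auto simp: transpose_def diag_matrix_def vec_eq_iff)

lemma diag_matrix_one: "diag_matrix (\<chi> k. 1) = mat 1"
  by (simp add: diag_matrix_def mat_def vec_eq_iff)

lemma diag_matrix_vector_mult: "(diag_matrix s *v y) $ k = s $ k * y $ k"
  by (simp add: matrix_vector_mult_def diag_matrix_def if_distrib[of "\<lambda>x. x * _"] cong: if_cong)

lemma norm_isometry_vector:
  fixes P :: "real^'r^'n"
  assumes "transpose P ** P = mat 1"
  shows "norm (P *v x) = norm x"
proof -
  have "(P *v x) \<bullet> (P *v x) = x \<bullet> x"
    by (simp add: gram_selfadjoint(1)[symmetric] assms)
  then show ?thesis by (simp add: norm_eq_sqrt_inner)
qed

lemma norm_transpose_isometry_vector: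
  fixes Q :: "real^'r^'n"
  assumes "transpose Q ** Q = mat 1"
  shows "norm (transpose Q *v x) \<le> norm x"
proof -
  have "(norm (transpose Q *v x))\<^sup>2 = x \<bullet> (Q *v (transpose Q *v x))"
    unfolding power2_norm_eq_inner by (rule inner_transpose_matrix_vector)
  also have "\<dots> \<le> norm x * norm (Q *v (transpose Q *v x))" by (rule norm_cauchy_schwarz)
  also have "\<dots> = norm x * norm (transpose Q *v x)" by (simp only: norm_isometry_vector[OF assms])
  finally have "norm (transpose Q *v x) * norm (transpose Q *v x) \<le> norm x * norm (transpose Q *v x)"
    by (simp only: power2_eq_square)
  then show ?thesis by (cases "norm (transpose Q *v x) = 0") auto
qed

lemma linear_kernel_in_subspace:
  fixes f :: "'a::euclidean_space \<Rightarrow> 'b::euclidean_space"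
  assumes f: "linear f" and R: "subspace R" and T: "f ` R \<subseteq> T" and dim: "dim T < dim R"
  obtains v where "v \<in> R" "v \<noteq> 0" "f v = 0"
proof -
  have "\<not> inj_on f R"
  proof
    assume "inj_on f R"
    then have "dim (f ` R) = dim R" using f R by (intro dim_image_eq) (simp_all add: span_eq_iff[THEN iffD2])
    with dim_subset[OF T] dim show False by simp
  qed
  then obtain x y where xy: "x \<in> R" "y \<in> R" "x \<noteq> y" "f x = f y" by (auto simp: inj_on_def)
  have "f (x - y) = 0" using xy(4) by (simp add: linear_diff[OF f])
  moreover have "x - y \<in> R" using xy R by (simp add: subspace_diff)
  ultimately show ?thesis using that xy(3) by (metis right_minus_eq)
qed

text \<open>
  A Weyl inequality: test on a vector of the row space of \<open>X\<close> that is orthogonal to all columns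
  of \<open>Q\<close> but the \<open>k\<close>-th.
\<close>

lemma svd_diagonal_lower_bound:
  fixes P :: "real^'r^'n1" and Q :: "real^'r^'n2" and X :: "real^'n2^'n1"
  assumes P: "transpose P ** P = mat 1" and Q: "transpose Q ** Q = mat 1"
    and r: "rank X = CARD('r)"
  shows "singular_value (CARD('r)) X - norm (P ** diag_matrix s ** transpose Q - X) \<le> \<bar>s $ k\<bar>"
proof -
  define M where "M = P ** diag_matrix s ** transpose Q"
  obtain R where R: "subspace R" "dim R = CARD('r)"
    and lower: "\<And>v. v \<in> R \<Longrightarrow> singular_value (CARD('r)) X * norm v \<le> norm (X *v v)"
    by (rule singular_value_rank[OF r]) (simp_all add: Suc_leI)
  \<comment> \<open>\<open>f\<close> deletes the \<open>k\<close>-th coordinate of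
    \<open>transpose Q *v v\<close>, so it maps \<open>R\<close> into a hyperplane of dimension less
    than \<open>dim R\<close>. A nonzero kernel vector in \<open>R\<close> is the test
    vector.\<close>
  define f where "f v = transpose Q *v v - ((transpose Q *v v) $ k) *\<^sub>R axis k 1" for v
  have f: "linear f"
    unfolding f_def by (intro linearI)
      (simp_all add: matrix_vector_right_distrib matrix_vector_mult_scaleR algebra_simps)
  have "axis k 1 \<noteq> (0 :: real^'r)" by simp
  then have "dim {y :: real^'r. axis k 1 \<bullet> y = 0} < dim R"
    using R(2) by (simp add: dim_hyperplane)
  moreover have "f ` R \<subseteq> {y. axis k 1 \<bullet> y = 0}"
    by (auto simp: f_def inner_axis inner_axis' )
  ultimately obtain v where v: "v \<in> R" "v \<noteq> 0" "f v = 0"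
    using linear_kernel_in_subspace[OF f R(1)] by blast
  define a where "a = (transpose Q *v v) $ k"
  have Qv: "transpose Q *v v = a *\<^sub>R axis k 1" using v(3) by (simp add: f_def a_def)
  have "diag_matrix s *v (a *\<^sub>R axis k 1) = s $ k *\<^sub>R (a *\<^sub>R axis k 1)"
    by (simp add: vec_eq_iff diag_matrix_vector_mult axis_def)
  then have "norm (M *v v) = norm (s $ k *\<^sub>R (a *\<^sub>R axis k (1::real) :: real^'r))"
    by (simp only: M_def matrix_vector_mul_assoc[symmetric] Qv norm_isometry_vector[OF P])
  also have "\<dots> = \<bar>s $ k\<bar> * norm (transpose Q *v v)" by (simp only: Qv norm_scaleR)
  also have "\<dots> \<le> \<bar>s $ k\<bar> * norm v"
    by (intro mult_left_mono norm_transpose_isometry_vector[OF Q]) simp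
  finally have "norm (M *v v) \<le> \<bar>s $ k\<bar> * norm v" .
  moreover have "norm (X *v v) \<le> norm (M *v v) + norm (M - X) * norm v"
    using norm_triangle_ineq4[of "M *v v" "(M - X) *v v"] norm_matrix_vector_mult_le[of "M - X" v]
    by (simp add: matrix_vector_mult_diff_rdistrib)
  ultimately have "singular_value (CARD('r)) X * norm v \<le> (\<bar>s $ k\<bar> + norm (M - X)) * norm v"
    using lower[OF v(1)] by (simp add: distrib_right)
  then show ?thesis using v(2) by (simp add: M_def)
qed

section \<open>Rank of a sum; the tangent projection, its lift to factors and its residual\<close>

lemma rank_add_le:
  fixes A B :: "real^'n^'m"
  shows "rank (A + B) \<le> rank A + rank B"
proof -
  let ?S = "range ((*v) A)" and ?T = "range ((*v) B)"
  have ST: "subspace ?S" "subspace ?T"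
    by (simp_all add: linear_subspace_image)
  have "range ((*v) (A + B)) \<subseteq> {x + y |x y. x \<in> ?S \<and> y \<in> ?T}"
    by (auto simp: matrix_vector_mult_add_rdistrib)
  then have "rank (A + B) \<le> dim {x + y |x y. x \<in> ?S \<and> y \<in> ?T}"
    unfolding rank_dim_range by (rule dim_subset)
  also have "\<dots> \<le> rank A + rank B"
    using dim_sums_Int[OF ST] by (simp add: rank_dim_range)
  finally show ?thesis .
qed

text \<open>When \<open>P\<close> and \<open>Q\<close> have orthonormal columns, this is the
  orthogonal projection to the space of all \<open>P ** S + T ** transpose Q\<close>. The second
  term only sees the part of \<open>N\<close> that the first one misses, so the two terms are
  orthogonal.\<close>

definition tangent_projection :: "real^'r^'n1 \<Rightarrow> real^'r^'n2 \<Rightarrow> real^'n2^'n1 \<Rightarrow> real^'n2^'n1" where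
  "tangent_projection P Q N =
     N ** (Q ** transpose Q) + (P ** transpose P) ** N ** (mat 1 - Q ** transpose Q)"

lemma column_projection:
  fixes Q :: "real^'r^'n"
  assumes "transpose Q ** Q = mat 1"
  shows "transpose (Q ** transpose Q) = Q ** transpose Q"
    and "(Q ** transpose Q) ** (Q ** transpose Q) = Q ** transpose Q"
    and "(Q ** transpose Q) ** Q = Q"
    and "transpose Q ** (Q ** transpose Q) = transpose Q"
    and "(mat 1 - Q ** transpose Q) ** Q = 0"
    and "transpose Q ** (mat 1 - Q ** transpose Q) = 0"
proof -
  show 1: "(Q ** transpose Q) ** Q = Q"
    using assms by (simp add: matrix_mul_assoc[symmetric])
  show 2: "transpose Q ** (Q ** transpose Q) = transpose Q"
    using assms by (simp add: matrix_mul_assoc)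
  show "(Q ** transpose Q) ** (Q ** transpose Q) = Q ** transpose Q"
    by (simp only: matrix_mul_assoc[symmetric, of Q] 2)
  show "transpose (Q ** transpose Q) = Q ** transpose Q"
    by (simp add: matrix_transpose_mul)
  show "(mat 1 - Q ** transpose Q) ** Q = 0" by (simp only: matrix_diff_rdistrib 1) simp
  show "transpose Q ** (mat 1 - Q ** transpose Q) = 0" by (simp only: matrix_diff_ldistrib 2) simp
qed

lemma norm_mult_inverse_diag_le:
  fixes A :: "real^'r^'m"
  assumes s: "\<And>k. \<mu> \<le> s $ k" and mu: "\<mu> > 0"
  shows "(norm (A ** diag_matrix (\<chi> k. 1 / sqrt (s $ k))))\<^sup>2 \<le> (norm A)\<^sup>2 / \<mu>"
proof -
  have "(norm (A ** diag_matrix (\<chi> k. 1 / sqrt (s $ k))))\<^sup>2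
      = (\<Sum>i\<in>UNIV. \<Sum>k\<in>UNIV. (A $ i $ k)\<^sup>2 / s $ k)"
    using s mu unfolding norm_matrix_square
    by (intro sum.cong refl) (simp add: matrix_mult_diag_matrix power_divide order.trans[of 0 \<mu>])
  also have "\<dots> \<le> (\<Sum>i\<in>UNIV. \<Sum>k\<in>UNIV. (A $ i $ k)\<^sup>2 / \<mu>)"
    using s mu by (intro sum_mono divide_left_mono mult_pos_pos) (auto intro: less_le_trans)
  also have "\<dots> = (norm A)\<^sup>2 / \<mu>"
    by (simp add: norm_matrix_square sum_divide_distrib)
  finally show ?thesis .
qed

lemma norm_mult_isometry:
  fixes Q :: "real^'r^'n" and N :: "real^'n^'m"
  assumes "transpose Q ** Q = mat 1"
  shows "(norm (N ** Q))\<^sup>2 = (norm (N ** (Q ** transpose Q)))\<^sup>2"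
proof -
  have "(N ** (Q ** transpose Q)) \<bullet> (N ** (Q ** transpose Q))
      = (N ** Q) \<bullet> (N ** (Q ** transpose Q) ** Q)"
    by (simp add: matrix_mul_assoc inner_matrix_mult_right[of "N ** Q" "transpose Q"])
  also have "N ** (Q ** transpose Q) ** Q = N ** Q"
    by (simp only: matrix_mul_assoc[symmetric] assms matrix_mul_rid)
  finally show ?thesis by (simp add: power2_norm_eq_inner)
qed

text \<open>\<open>dU\<close> produces the first term of the projection and \<open>dV\<close> the
  second. Undoing the balanced factor \<open>D\<close> by \<open>E\<close> costs a factor of at most
  \<open>1 / sqrt \<mu>\<close>, and the two parts of \<open>N\<close> involved are orthogonal, so
  no factor 2 is lost in the sum of squares.\<close>

lemma tangent_lift:
  fixes P :: "real^'r^'n1" and Q :: "real^'r^'n2" and N :: "real^'n2^'n1"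
  assumes P: "transpose P ** P = mat 1" and Q: "transpose Q ** Q = mat 1"
    and s: "\<And>k. \<mu> \<le> s $ k" and mu: "\<mu> > 0"
    and U: "U = P ** diag_matrix (\<chi> k. sqrt (s $ k))"
    and V: "V = Q ** diag_matrix (\<chi> k. sqrt (s $ k))"
  obtains dU dV where
    "U ** transpose dV + dU ** transpose V = tangent_projection P Q N"
    "(norm dU)\<^sup>2 + (norm dV)\<^sup>2 \<le> (norm N)\<^sup>2 / \<mu>"
proof -
  define E where "E = diag_matrix (\<chi> k. 1 / sqrt (s $ k))"
  define D where "D = diag_matrix (\<chi> k. sqrt (s $ k))"
  define C where "C = mat 1 - Q ** transpose Q"
  have pos: "s $ k > 0" for k using s mu by (rule less_le_trans[rotated])
  have DE: "D ** E = mat 1" "E ** D = mat 1"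
    using pos by (simp_all add: D_def E_def diag_matrix_mult less_imp_neq[symmetric] diag_matrix_one)
  have C: "transpose C = C" by (simp add: C_def transpose_diff transpose_mat matrix_transpose_mul)
  define dU where "dU = (N ** Q) ** E"
  define dV where "dV = (C ** transpose N ** P) ** E"
  have "U ** transpose dV + dU ** transpose V = tangent_projection P Q N"
  proof -
    have "U ** transpose dV = P ** (D ** E) ** transpose P ** N ** C"
      by (simp add: U D_def[symmetric] dV_def matrix_transpose_mul C matrix_mul_assoc)
        (simp add: E_def transpose_diag_matrix)
    moreover have "dU ** transpose V = N ** Q ** (E ** D) ** transpose Q"
      by (simp add: V D_def[symmetric] dU_def matrix_transpose_mul matrix_mul_assoc)
        (simp add: D_def transpose_diag_matrix)
    ultimately show ?thesis
      by (simp add: DE tangent_projection_def C_def matrix_mul_assoc add.commute)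
  qed
  moreover have "(norm dU)\<^sup>2 + (norm dV)\<^sup>2 \<le> (norm N)\<^sup>2 / \<mu>"
  proof -
    have "(norm dU)\<^sup>2 \<le> (norm (N ** (Q ** transpose Q)))\<^sup>2 / \<mu>"
      using norm_mult_inverse_diag_le[OF s mu, of "N ** Q"]
      by (simp only: dU_def E_def norm_mult_isometry[OF Q])
    moreover have "(norm dV)\<^sup>2 \<le> (norm (N ** C))\<^sup>2 / \<mu>"
    proof -
      have "(norm dV)\<^sup>2 \<le> (norm ((C ** transpose N) ** P))\<^sup>2 / \<mu>"
        using norm_mult_inverse_diag_le[OF s mu, of "(C ** transpose N) ** P"]
        by (simp only: dV_def E_def)
      also have "\<dots> \<le> (norm (C ** transpose N))\<^sup>2 / \<mu>"
        using mu norm_orthogonal_projection_right[OF column_projection(1,2)[OF P], of "C ** transpose N"]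
        by (intro divide_right_mono) (simp_all add: norm_mult_isometry[OF P])
      also have "norm (C ** transpose N) = norm (N ** C)"
        using norm_transpose[of "N ** C"] by (simp add: matrix_transpose_mul C)
      finally show ?thesis .
    qed
    ultimately show ?thesis
      using norm_orthogonal_projection_right[OF column_projection(1,2)[OF Q], of N]
      by (simp add: C_def add_divide_distrib)
  qed
  ultimately show ?thesis by (rule that)
qed

text \<open>Both the current iterate and every linearized update have the form projected
  here.\<close>

lemma tangent_projection_tangent:
  fixes P :: "real^'r^'n1" and Q :: "real^'r^'n2"
  assumes P: "transpose P ** P = mat 1" and Q: "transpose Q ** Q = mat 1"
  shows "tangent_projection P Q (P ** S + T ** transpose Q) = P ** S + T ** transpose Q"
proof -
  define C where "C = mat 1 - Q ** transpose Q"
  have 1: "T ** transpose Q ** (Q ** transpose Q) = T ** transpose Q"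
    by (simp only: matrix_mul_assoc[symmetric, of T] column_projection(4)[OF Q])
  have 2: "T ** transpose Q ** C = 0"
    by (simp only: C_def matrix_mul_assoc[symmetric, of T] column_projection(6)[OF Q]) simp
  have 3: "(P ** transpose P) ** (P ** S) = P ** S"
    by (simp only: matrix_mul_assoc column_projection(3)[OF P, unfolded matrix_mul_assoc])
  have "tangent_projection P Q (P ** S + T ** transpose Q)
      = (P ** S) ** (Q ** transpose Q) + T ** transpose Q
        + ((P ** S) ** C + (P ** transpose P) ** (T ** transpose Q ** C))"
    unfolding tangent_projection_def C_def[symmetric]
    by (simp only: matrix_add_ldistrib matrix_add_rdistrib 1 3 matrix_mul_assoc[symmetric, of "P ** transpose P"])
  also have "\<dots> = (P ** S) ** (Q ** transpose Q + C) + T ** transpose Q"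
    by (simp add: 2 matrix_add_ldistrib)
  finally show ?thesis by (simp add: C_def)
qed

text \<open>The product form bounds the rank of the residual, as needed for the RIP, and exhibits
  the block estimated in \<open>tangent_residual_le\<close>.\<close>

lemma tangent_residual_eq:
  "X - tangent_projection P Q X = (mat 1 - P ** transpose P) ** X ** (mat 1 - Q ** transpose Q)"
  by (simp add: tangent_projection_def matrix_diff_ldistrib matrix_diff_rdistrib)

text \<open>
  The residual of the tangent projection is quadratically small, since it factors through the
  row space of \<open>X\<close> as \<open>F1 \<circ> (X restricted to its row space)\<^sup>-\<^sup>1 \<circ> F2\<close> with \<open>F1\<close>, \<open>F2\<close> two blocks of
  \<open>X - M\<close>. Counting their common block only once gains the factor of almost 1/2.
\<close>

lemma tangent_residual_le:
  fixes P :: "real^'r^'n1" and Q :: "real^'r^'n2" and X :: "real^'n2^'n1"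
  assumes P: "transpose P ** P = mat 1" and Q: "transpose Q ** Q = mat 1"
    and M: "M = P ** S ** transpose Q"
    and r: "rank X = r" "r \<ge> 1"
    and e: "norm (X - M) \<le> singular_value r X / 7"
  shows "norm (X - tangent_projection P Q X) \<le> 25 / 49 * (norm (X - M))\<^sup>2 / singular_value r X"
proof -
  define \<sigma> where "\<sigma> = singular_value r X"
  define e where "e = norm (X - M)"
  define Pc where "Pc = mat 1 - P ** transpose P"
  define Qc where "Qc = mat 1 - Q ** transpose Q"
  define F1 where "F1 = Pc ** (X - M)"
  define F2 where "F2 = (X - M) ** Qc"
  define q where "q = norm (Pc ** X ** Qc)"
  obtain R where R: "\<sigma> > 0" "\<And>v. v \<in> R \<Longrightarrow> \<sigma> * norm v \<le> norm (X *v v)"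
    "\<And>v. \<exists>h\<in>R. X *v h = X *v v"
    using singular_value_rank[OF r] unfolding \<sigma>_def by metis
  have PcM: "Pc ** M = 0"
    unfolding M Pc_def by (simp add: matrix_mul_assoc column_projection(5)[OF P])
  have MQc: "M ** Qc = 0"
    unfolding M Qc_def by (simp only: matrix_mul_assoc[symmetric] column_projection(6)[OF Q]) simp
  have F1: "F1 = Pc ** X" by (simp add: F1_def matrix_diff_ldistrib PcM)
  have F2: "F2 = X ** Qc" by (simp add: F2_def matrix_diff_rdistrib MQc)
  have "norm (F1 ** Qc) \<le> norm F1 / \<sigma> * norm F2"
  proof (rule norm_matrix_le_by_columns)
    fix v
    \<comment> \<open>\<open>h\<close> replaces \<open>Qc *v v\<close> without changing its image
      under \<open>X\<close>, hence under \<open>F1 = Pc ** X\<close>. Lying in the row space, it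
      has norm at most \<open>norm (F2 *v v) / \<sigma>\<close>.\<close>
    obtain h where h: "h \<in> R" "X *v h = X *v (Qc *v v)" using R(3) by blast
    have "norm ((F1 ** Qc) *v v) = norm (F1 *v h)"
      by (simp add: F1 matrix_vector_mul_assoc[symmetric] h(2))
    also have "\<dots> \<le> norm F1 * norm h" by (rule norm_matrix_vector_mult_le)
    also have "\<dots> \<le> norm F1 * (norm (F2 *v v) / \<sigma>)"
      using R(1) R(2)[OF h(1)] h(2)
      by (intro mult_left_mono) (simp_all add: F2 matrix_vector_mul_assoc[symmetric] pos_le_divide_eq mult.commute)
    finally show "norm ((F1 ** Qc) *v v) \<le> norm F1 / \<sigma> * norm (F2 *v v)" by simp
  qed (use R(1) in simp)
  then have q1: "\<sigma> * q \<le> norm F1 * norm F2"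
    using R(1) by (simp add: q_def F1 field_simps)
  have a1: "(norm F1)\<^sup>2 = (norm (F1 ** (Q ** transpose Q)))\<^sup>2 + q\<^sup>2"
    using norm_orthogonal_projection_right[OF column_projection(1,2)[OF Q], of F1]
    by (simp add: q_def F1 Qc_def)
  have a2: "(norm (F1 ** (Q ** transpose Q)))\<^sup>2 \<le> (norm ((X - M) ** (Q ** transpose Q)))\<^sup>2"
    using norm_orthogonal_projection_left[OF column_projection(1,2)[OF P], of "(X - M) ** (Q ** transpose Q)"]
    by (simp add: F1_def Pc_def matrix_mul_assoc)
  have a3: "e\<^sup>2 = (norm ((X - M) ** (Q ** transpose Q)))\<^sup>2 + (norm F2)\<^sup>2"
    using norm_orthogonal_projection_right[OF column_projection(1,2)[OF Q], of "X - M"]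
    by (simp add: e_def F2_def Qc_def)
  have a4: "e\<^sup>2 = (norm ((P ** transpose P) ** (X - M)))\<^sup>2 + (norm F1)\<^sup>2"
    using norm_orthogonal_projection_left[OF column_projection(1,2)[OF P], of "X - M"]
    by (simp add: e_def F1_def Pc_def)
  \<comment> \<open>\<open>F1\<close> and \<open>F2\<close> share the block
    \<open>Pc ** X ** Qc\<close> of norm \<open>q\<close>; apart from it they are disjoint blocks of
    \<open>X - M\<close>.\<close>
  have sum: "(norm F1)\<^sup>2 + (norm F2)\<^sup>2 \<le> e\<^sup>2 + q\<^sup>2" using a1 a2 a3 by linarith
  have le: "(norm F1)\<^sup>2 \<le> e\<^sup>2" "(norm F2)\<^sup>2 \<le> e\<^sup>2"
    by (simp_all add: a4) (simp add: a3 flip: a4)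
  have e0: "e \<ge> 0" "q \<ge> 0" by (simp_all add: e_def q_def)
  have q2: "2 * (\<sigma> * q) \<le> e\<^sup>2 + q\<^sup>2"
    using sum q1 sum_squares_bound[of "norm F1" "norm F2"] by linarith
  \<comment> \<open>This crude bound yields \<open>q \<le> e / 7\<close>, which put into
    \<open>q2\<close> gives the constant \<open>(1 + 1/49) / 2 = 25/49\<close>.\<close>
  have "norm F1 * norm F2 \<le> e * e"
    using le e0 by (intro mult_mono) (simp_all add: power2_le_iff_abs_le)
  with q1 have q3: "\<sigma> * q \<le> e * e" by linarith
  also have "\<dots> \<le> \<sigma> / 7 * e" using assms(6) e0 by (intro mult_right_mono) (simp_all add: e_def \<sigma>_def)
  finally have "q \<le> e / 7" using R(1) by simp
  then have "q\<^sup>2 \<le> (e / 7)\<^sup>2" using e0 by (intro power_mono)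
  then have "\<sigma> * q \<le> 25 / 49 * e\<^sup>2" using q2 by (simp add: power_divide)
  then have "q \<le> 25 / 49 * e\<^sup>2 / \<sigma>" using R(1) by (simp add: field_simps)
  then show ?thesis
    by (simp only: tangent_residual_eq q_def e_def \<sigma>_def Pc_def Qc_def)
qed

subsection \<open>One iteration\<close>

text \<open>Minimality along the line through \<open>W\<close> and \<open>Y\<close> makes the
  residual \<open>A W - b\<close> orthogonal to \<open>d = A (W - Y)\<close>. As
  \<open>d = (A W - b) + (b - A Y)\<close>, only the second summand contributes to
  \<open>d \<bullet> d\<close>, and Cauchy-Schwarz applies.\<close>

lemma least_squares_error_le:
  fixes A :: "'a::real_vector \<Rightarrow> 'b::real_inner"
  assumes A: "linear A"
    and min: "\<And>t. norm (A W - b) \<le> norm (A (W + t *\<^sub>R (W - Y)) - b)"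
  shows "norm (A (W - Y)) \<le> norm (b - A Y)"
proof -
  define a where "a = A W - b"
  define d where "d = A (W - Y)"
  have "- 2 * (a \<bullet> d) = 0"
  proof (rule quadratic_dominates_linear[where C = "d \<bullet> d"])
    fix t :: real
    have "A (W + t *\<^sub>R (W - Y)) - b = a + t *\<^sub>R d"
      by (simp only: a_def d_def linear_add[OF A] linear_scale[OF A]) simp
    then have "a \<bullet> a \<le> (a + t *\<^sub>R d) \<bullet> (a + t *\<^sub>R d)"
      using min[of t] by (simp add: norm_le a_def[symmetric])
    then show "- 2 * (a \<bullet> d) * t \<le> d \<bullet> d * t\<^sup>2"
      by (simp add: inner_add_left inner_add_right inner_commute power2_eq_square algebra_simps)
  qed
  then have ad: "a \<bullet> d = 0" by simp
  have "(norm d)\<^sup>2 = (a + (b - A Y)) \<bullet> d"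
    by (simp add: power2_norm_eq_inner a_def d_def linear_diff[OF A])
  also have "\<dots> = (b - A Y) \<bullet> d" by (simp add: inner_add_left ad)
  also have "\<dots> \<le> norm (b - A Y) * norm d" by (rule norm_cauchy_schwarz)
  finally have "norm d * norm d \<le> norm (b - A Y) * norm d" by (simp add: power2_eq_square)
  then show ?thesis unfolding d_def[symmetric] by (cases "norm d = 0") auto
qed

text \<open>The orthonormal columns of \<open>Q\<close> force
  \<open>CARD('r) \<le> CARD('n2)\<close>, so every \<open>p k\<close> is a position at which
  \<open>singular_value\<close> is meaningful.\<close>

lemma svd_diagonal_nonneg:
  fixes M :: "real^'n2^'n1" and P :: "real^'r^'n1"
  assumes "is_rank_svd M P s Q"
  shows "0 \<le> s $ k"
proof -
  from assms obtain p where p: "bij_betw p (UNIV :: 'r set) {1..CARD('r)}" "s $ k = singular_value (p k) M"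
    and Q: "transpose Q ** Q = mat 1"
    unfolding is_rank_svd_def by blast
  have "CARD('r) = rank (transpose Q ** Q)" by (simp only: Q rank_I)
  also have "\<dots> \<le> rank Q" by (rule rank_mul_le_right)
  also have "\<dots> \<le> CARD('n2)" using rank_bound[of Q] by simp
  finally have "CARD('r) \<le> CARD('n2)" .
  moreover have "p k \<in> {1..CARD('r)}" using p(1) by (auto simp: bij_betw_def)
  ultimately show ?thesis unfolding p(2) by (intro singular_value_nonneg) auto
qed

text \<open>The sign matters: for a negative entry, \<open>sqrt (s $ k) * sqrt (s $ k)\<close> would
  be \<open>- s $ k\<close>.\<close>

lemma svd_factors_mult:
  assumes s: "\<And>k. 0 \<le> s $ k"
    and U: "U = P ** diag_matrix (\<chi> k. sqrt (s $ k))"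
    and V: "V = Q ** diag_matrix (\<chi> k. sqrt (s $ k))"
  shows "U ** transpose V = P ** diag_matrix s ** transpose Q"
proof -
  have "U ** transpose V
      = P ** (diag_matrix (\<chi> k. sqrt (s $ k)) ** diag_matrix (\<chi> k. sqrt (s $ k))) ** transpose Q"
    by (simp add: U V matrix_transpose_mul transpose_diag_matrix matrix_mul_assoc)
  also have "\<dots> = P ** diag_matrix s ** transpose Q"
    using s by (simp add: diag_matrix_mult)
  finally show ?thesis .
qed

lemma svd_balancing_product:
  assumes "svd_balancing U' V' U V"
  shows "U ** transpose V = U' ** transpose V'"
proof -
  from assms obtain P s Q where svd: "is_rank_svd (U' ** transpose V') P s Q"
    and UV: "U = P ** diag_matrix (\<chi> k. sqrt (s $ k))" "V = Q ** diag_matrix (\<chi> k. sqrt (s $ k))"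
    unfolding svd_balancing_def by blast
  have "U ** transpose V = P ** diag_matrix s ** transpose Q"
    using svd_diagonal_nonneg[OF svd] UV by (rule svd_factors_mult)
  with svd show ?thesis by (simp add: is_rank_svd_def)
qed

text \<open>The derivative of the product \<open>U ** transpose V\<close> in the direction
  \<open>(dU, dV)\<close>.\<close>

definition factor_update :: "real^'r^'n1 \<Rightarrow> real^'r^'n2 \<Rightarrow> real^'r^'n1 \<Rightarrow> real^'r^'n2 \<Rightarrow> real^'n2^'n1" where
  "factor_update U V dU dV = U ** transpose dV + dU ** transpose V"

lemma transpose_add:
  fixes A B :: "real^'n^'m"
  shows "transpose (A + B) = transpose A + transpose B"
  by (simp add: transpose_def vec_eq_iff)

lemma factor_update_add:
  "factor_update U V (a + c) (b + d) = factor_update U V a b + factor_update U V c d"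
  by (simp add: factor_update_def transpose_add matrix_add_ldistrib matrix_add_rdistrib)

lemma factor_update_diff:
  "factor_update U V (a - c) (b - d) = factor_update U V a b - factor_update U V c d"
  by (simp add: factor_update_def transpose_diff matrix_diff_ldistrib matrix_diff_rdistrib)

lemma factor_update_scaleR:
  "factor_update U V (t *\<^sub>R a) (t *\<^sub>R b) = t *\<^sub>R factor_update U V a b"
  by (simp add: factor_update_def transpose_scalar matrix_scalar_ac scalar_matrix_assoc[symmetric] scaleR_add_right)

text \<open>Two summands of rank at most \<open>CARD('r)\<close> each; this is why the RIP is taken
  at \<open>2 * CARD('r)\<close>.\<close>

lemma rank_factor_update:
  fixes U :: "real^'r^'n1"
  shows "rank (factor_update U V dU dV) \<le> 2 * CARD('r)"
proof -
  have "rank (U ** transpose dV) \<le> CARD('r)" "rank (dU ** transpose V) \<le> CARD('r)"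
    using rank_mul_le_left[of U "transpose dV"] rank_bound[of U]
      rank_mul_le_left[of dU "transpose V"] rank_bound[of dU] by auto
  then show ?thesis
    using rank_add_le[of "U ** transpose dV" "dU ** transpose V"] by (simp add: factor_update_def)
qed

lemma tangent_projection_diff:
  "tangent_projection P Q (A - B) = tangent_projection P Q A - tangent_projection P Q B"
  by (simp add: tangent_projection_def matrix_diff_ldistrib matrix_diff_rdistrib)

text \<open>The part \<open>N ** R\<close> is kept unchanged, while the orthogonal part
  \<open>N ** C\<close> is only shrunk by \<open>P ** transpose P\<close>.\<close>

lemma norm_tangent_projection_le:
  fixes P :: "real^'r^'n1" and Q :: "real^'r^'n2" and N :: "real^'n2^'n1"
  assumes P: "transpose P ** P = mat 1" and Q: "transpose Q ** Q = mat 1"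
  shows "norm (tangent_projection P Q N) \<le> norm N"
proof -
  define R where "R = Q ** transpose Q"
  define C where "C = mat 1 - R"
  have RR: "R ** R = R" unfolding R_def by (rule column_projection(2)[OF Q])
  have RC: "R ** C = 0" "C ** R = 0" "C ** C = C"
    by (simp_all add: C_def matrix_diff_ldistrib matrix_diff_rdistrib RR)
  define T where "T = tangent_projection P Q N"
  have T: "T = N ** R + (P ** transpose P) ** (N ** C)"
    by (simp add: T_def tangent_projection_def R_def C_def matrix_mul_assoc)
  have TR: "T ** R = N ** R" "T ** C = (P ** transpose P) ** (N ** C)"
    by (simp_all add: T matrix_add_rdistrib matrix_mul_assoc[symmetric] RR RC)
  have "(norm T)\<^sup>2 = (norm (N ** R))\<^sup>2 + (norm ((P ** transpose P) ** (N ** C)))\<^sup>2"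
    using norm_orthogonal_projection_right[OF column_projection(1,2)[OF Q], of T]
    unfolding R_def[symmetric] C_def[symmetric] TR .
  also have "\<dots> \<le> (norm (N ** R))\<^sup>2 + (norm (N ** C))\<^sup>2"
    using norm_orthogonal_projection_left[OF column_projection(1,2)[OF P], of "N ** C"] by simp
  also have "\<dots> = (norm N)\<^sup>2"
    using norm_orthogonal_projection_right[OF column_projection(1,2)[OF Q], of N]
    by (simp add: R_def C_def)
  finally show ?thesis unfolding T_def by (rule power2_le_imp_le) simp
qed

text \<open>
  Here \<open>q\<close> is the tangent residual, \<open>w\<close> the least-squares error
  on the tangent space, \<open>e + w\<close> bounds the size of the update and \<open>n\<close> the neglected
  second-order term.
\<close>

lemma step_arithmetic:
  fixes e q w n \<eta> \<sigma> \<kappa> :: real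
  assumes pos: "\<sigma> > 0" "\<kappa> \<ge> 1" "e \<ge> 0" "\<eta> \<ge> 0" "w \<ge> 0"
    and e: "e \<le> \<sigma> / (7 * \<kappa> ^ 3)" and eta: "\<eta> \<le> \<sigma> / (42 * \<kappa> ^ 3)"
    and q: "q \<le> 25 / 49 * e\<^sup>2 / \<sigma>" and w: "w \<le> \<kappa> * q + \<eta>"
    and n: "n \<le> (e + w)\<^sup>2 / (2 * (6 / 7 * \<sigma>))"
  shows "q + w + n \<le> 7 * \<kappa> ^ 3 / (4 * \<sigma>) * e\<^sup>2 + 3 * \<eta>"
proof -
  define x where "x = e\<^sup>2 / \<sigma>"
  have x0: "x \<ge> 0" using pos by (simp add: x_def)
  have k3: "\<kappa> ^ 3 \<ge> \<kappa>" using pos power_increasing[of 1 3 \<kappa>] by simp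
  have k1: "\<kappa> ^ 3 \<ge> 1" using k3 pos by linarith
  have kpos: "\<kappa> > 0" using pos by linarith
  have "\<kappa> * e \<le> \<kappa> ^ 3 * e" using k3 pos by (intro mult_right_mono)
  also have "\<dots> \<le> \<sigma> / 7" using e kpos by (simp add: field_simps)
  finally have ke: "\<kappa> * e \<le> \<sigma> / 7" .
  have e7: "e \<le> \<sigma> / 7" using ke mult_right_mono[OF pos(2) pos(3)] by simp
  have "\<eta> \<le> \<kappa> ^ 3 * \<eta>" using k1 pos by (simp add: mult_right_mono[of 1 "\<kappa> ^ 3" \<eta>, simplified])
  also have "\<dots> \<le> \<sigma> / 42" using eta kpos by (simp add: field_simps)
  finally have eta42: "\<eta> \<le> \<sigma> / 42" .
  have "\<kappa> * x = (\<kappa> * e) * e / \<sigma>" by (simp add: x_def power2_eq_square)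
  also have "\<dots> \<le> (\<sigma> / 7) * e / \<sigma>" using ke pos by (intro divide_right_mono mult_right_mono) auto
  finally have kx: "\<kappa> * x \<le> e / 7" using pos by simp
  have qx: "q \<le> 25 / 49 * x" using q by (simp add: x_def)
  have "\<kappa> * q \<le> \<kappa> * (25 / 49 * x)" using qx pos by (intro mult_left_mono) auto
  then have wx: "w \<le> 25 / 49 * (\<kappa> * x) + \<eta>" using w by simp
  \<comment> \<open>\<open>368 / 343 = 1 + 25 / (49 * 7)\<close>.\<close>
  then have "e + w \<le> 368 / 343 * e + \<eta>" using kx by linarith
  then have "(e + w)\<^sup>2 \<le> (368 / 343 * e + \<eta>)\<^sup>2" using pos by (intro power_mono) auto
  also have "\<dots> = (368 / 343)\<^sup>2 * e\<^sup>2 + (736 / 343 * e + \<eta>) * \<eta>"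
    by (simp add: power2_eq_square algebra_simps)
  \<comment> \<open>\<open>736 / 343 * e + \<eta>\<close> is at most
    \<open>(736 / 2401 + 1 / 42) * \<sigma>\<close>, which is below
    \<open>\<sigma> / 3\<close>.\<close>
  also have "\<dots> \<le> (368 / 343)\<^sup>2 * e\<^sup>2 + (\<sigma> / 3) * \<eta>"
    using e7 eta42 pos by (intro add_left_mono mult_right_mono) auto
  finally have "(e + w)\<^sup>2 / (2 * (6 / 7 * \<sigma>)) \<le> ((368 / 343)\<^sup>2 * e\<^sup>2 + (\<sigma> / 3) * \<eta>) / (2 * (6 / 7 * \<sigma>))"
    using pos by (intro divide_right_mono) auto
  also have "\<dots> = 7 / 12 * (368 / 343)\<^sup>2 * x + 7 / 36 * \<eta>"
    using pos by (simp add: x_def field_simps)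
  finally have nx: "n \<le> 7 / 12 * (368 / 343)\<^sup>2 * x + 7 / 36 * \<eta>" using n by linarith
  have "x \<le> \<kappa> ^ 3 * x" "\<kappa> * x \<le> \<kappa> ^ 3 * x"
    using k1 k3 x0 mult_right_mono[of 1 "\<kappa> ^ 3" x] by (auto intro: mult_right_mono)
  \<comment> \<open>The coefficients satisfy
    \<open>25/49 + 25/49 + 7/12 * (368/343)\<^sup>2 < 7/4\<close> and
    \<open>1 + 7/36 < 3\<close>.\<close>
  then have "q + w + n \<le> 7 / 4 * (\<kappa> ^ 3 * x) + 3 * \<eta>"
    using qx wx nx pos(4) x0 by (simp add: power2_eq_square)
  also have "\<dots> = 7 * \<kappa> ^ 3 / (4 * \<sigma>) * e\<^sup>2 + 3 * \<eta>" by (simp add: x_def)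
  finally show ?thesis .
qed

text \<open>The new error splits exactly into the least-squares error \<open>W - Y\<close>, the
  tangent residual \<open>X - Y\<close> and the second-order term \<open>dU ** transpose dV\<close>;
  \<open>step_arithmetic\<close> adds up their bounds. The factor \<open>7 * \<kappa> ^ 3\<close> is
  the constant \<open>c\<close> of the theorem.\<close>

lemma gnmr_step:
  fixes A :: "real^'n2^'n1 \<Rightarrow> real^'m" and U dU :: "real^'r^'n1" and V dV :: "real^'r^'n2"
  assumes A: "linear A" and rip: "RIP (2 * CARD('r)) \<delta> A"
    and b: "b = A X + \<xi>" and r: "rank X = CARD('r)"
    and \<sigma>: "\<sigma> = singular_value (CARD('r)) X"
    and \<kappa>: "\<kappa> = sqrt ((1 + \<delta>) / (1 - \<delta>))" and \<eta>: "\<eta> = norm \<xi> / sqrt (1 - \<delta>)"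
    and bal: "svd_balancing U' V' U V" and dir: "gnmr_direction A b U V dU dV"
    and e_le: "norm (U ** transpose V - X) \<le> \<sigma> / (7 * \<kappa> ^ 3)"
    and \<eta>_le: "\<eta> \<le> \<sigma> / (42 * \<kappa> ^ 3)"
  shows "norm ((U + dU) ** transpose (V + dV) - X)
      \<le> 7 * \<kappa> ^ 3 / (4 * \<sigma>) * (norm (U ** transpose V - X))\<^sup>2 + 3 * \<eta>"
proof -
  let ?L = "factor_update U V"
  from bal obtain P s Q where svd: "is_rank_svd (U' ** transpose V') P s Q"
    and U: "U = P ** diag_matrix (\<chi> k. sqrt (s $ k))" and V: "V = Q ** diag_matrix (\<chi> k. sqrt (s $ k))"
    unfolding svd_balancing_def by blast
  have P: "transpose P ** P = mat 1" and Q: "transpose Q ** Q = mat 1"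
    using svd by (auto simp: is_rank_svd_def)
  define M where "M = U ** transpose V"
  have M: "M = P ** diag_matrix s ** transpose Q"
    unfolding M_def using svd_diagonal_nonneg[OF svd] U V by (rule svd_factors_mult)
  define e where "e = norm (M - X)"
  have r1: "(1::nat) \<le> CARD('r)" by (simp add: Suc_leI)
  have \<sigma>0: "\<sigma> > 0" unfolding \<sigma> by (rule singular_value_rank[OF r r1])
  have \<delta>: "0 \<le> \<delta>" "\<delta> < 1" using rip by (simp_all add: RIP_def)
  have \<kappa>1: "\<kappa> \<ge> 1" using \<delta> by (simp add: \<kappa> pos_le_divide_eq)
  have "\<sigma> / (7 * \<kappa> ^ 3) \<le> \<sigma> / 7"
    using \<sigma>0 one_le_power[OF \<kappa>1, of 3] \<kappa>1 by (intro divide_left_mono) auto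
  then have e7: "e \<le> \<sigma> / 7" using e_le by (simp add: e_def M_def)
  \<comment> \<open>By the Weyl inequality an error of at most \<open>\<sigma> / 7\<close> leaves
    every diagonal entry at least \<open>6 / 7 * \<sigma>\<close>.\<close>
  define \<mu> where "\<mu> = 6 / 7 * \<sigma>"
  have \<mu>0: "\<mu> > 0" using \<sigma>0 by (simp add: \<mu>_def)
  have s: "\<mu> \<le> s $ k" for k
    using svd_diagonal_lower_bound[OF P Q r, of s k] svd_diagonal_nonneg[OF svd, of k] e7
    by (simp add: M[symmetric] \<sigma>[symmetric] e_def \<mu>_def)
  have lift: "\<exists>a c. ?L a c = tangent_projection P Q N \<and> (norm a)\<^sup>2 + (norm c)\<^sup>2 \<le> (norm N)\<^sup>2 / \<mu>" for N
    using tangent_lift[OF P Q s \<mu>0 U V, of N] unfolding factor_update_def by metis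
  have L_tangent: "tangent_projection P Q (?L a c) = ?L a c" for a c
    using tangent_projection_tangent[OF P Q, of "diag_matrix (\<chi> k. sqrt (s $ k)) ** transpose c"
        "a ** diag_matrix (\<chi> k. sqrt (s $ k))"]
    by (simp add: factor_update_def U V matrix_transpose_mul transpose_diag_matrix matrix_mul_assoc)
  have M_tangent: "tangent_projection P Q M = M"
    using tangent_projection_tangent[OF P Q, of "diag_matrix s ** transpose Q" 0]
    by (simp add: M matrix_mul_assoc)
  have obj: "gnmr_objective A b U V (a, c) = (norm (A (M + ?L a c) - b))\<^sup>2" for a c
    by (simp add: gnmr_objective_def factor_update_def M_def add.assoc)
  have min: "norm (A (M + ?L dU dV) - b) \<le> norm (A (M + ?L a c) - b)" for a c
  proof -
    have "gnmr_objective A b U V (dU, dV) \<le> gnmr_objective A b U V (a, c)"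
      using dir by (auto simp: gnmr_direction_def is_arg_min_def not_less)
    then show ?thesis unfolding obj by (simp add: power2_le_iff_abs_le)
  qed
  have min_norm: "(norm dU)\<^sup>2 + (norm dV)\<^sup>2 \<le> (norm a)\<^sup>2 + (norm c)\<^sup>2" if "?L a c = ?L dU dV" for a c
  proof -
    have "gnmr_objective A b U V (a, c) = gnmr_objective A b U V (dU, dV)" by (simp only: obj that)
    then have "is_arg_min (gnmr_objective A b U V) (\<lambda>_. True) (a, c)"
      using dir by (simp add: gnmr_direction_def is_arg_min_linorder)
    then show ?thesis
      using dir by (simp add: gnmr_direction_def is_arg_min_linorder[where x = "(dU, dV)"])
  qed
  define Y where "Y = tangent_projection P Q X"
  define W where "W = M + ?L dU dV"
  define q where "q = norm (X - Y)"
  define w where "w = norm (W - Y)"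
  \<comment> \<open>This preimage places \<open>Y\<close> in \<open>M\<close> plus the range of
    \<open>?L\<close>, so that \<open>Y\<close> competes in the least-squares problem.\<close>
  obtain a c where "?L a c = tangent_projection P Q (X - M)" and "(norm a)\<^sup>2 + (norm c)\<^sup>2 \<le> (norm (X - M))\<^sup>2 / \<mu>"
    using lift by blast
  then have Y: "Y = M + ?L a c" by (simp add: Y_def tangent_projection_diff M_tangent)
  have WY: "W - Y = ?L (dU - a) (dV - c)" by (simp add: W_def Y factor_update_diff)
  have bound: "sqrt (1 - \<delta>) * norm Z \<le> norm (A Z)" "norm (A Z) \<le> sqrt (1 + \<delta>) * norm Z"
    if "rank Z \<le> 2 * CARD('r)" for Z
  proof -
    have Z: "(1 - \<delta>) * (norm Z)\<^sup>2 \<le> (norm (A Z))\<^sup>2" "(norm (A Z))\<^sup>2 \<le> (1 + \<delta>) * (norm Z)\<^sup>2"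
      using rip that by (auto simp: RIP_def)
    show "sqrt (1 - \<delta>) * norm Z \<le> norm (A Z)"
      by (rule power2_le_imp_le) (use Z(1) \<delta> in \<open>simp_all add: power_mult_distrib\<close>)
    show "norm (A Z) \<le> sqrt (1 + \<delta>) * norm Z"
      by (rule power2_le_imp_le) (use Z(2) \<delta> in \<open>simp_all add: power_mult_distrib\<close>)
  qed
  have "norm (A (W - Y)) \<le> norm (b - A Y)"
  proof (rule least_squares_error_le[OF A])
    fix t
    have "W + t *\<^sub>R (W - Y) = M + ?L (dU + t *\<^sub>R (dU - a)) (dV + t *\<^sub>R (dV - c))"
      by (simp only: WY) (simp add: W_def factor_update_add factor_update_scaleR)
    then show "norm (A W - b) \<le> norm (A (W + t *\<^sub>R (W - Y)) - b)"
      using min by (simp only: W_def)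
  qed
  also have "\<dots> = norm (A (X - Y) + \<xi>)" by (simp add: b linear_diff[OF A] algebra_simps)
  also have "\<dots> \<le> sqrt (1 + \<delta>) * q + norm \<xi>"
  proof -
    have "rank (X - Y) \<le> CARD('r)"
      unfolding Y_def tangent_residual_eq r[symmetric]
      by (meson order_trans rank_mul_le_left rank_mul_le_right)
    then have "norm (A (X - Y)) \<le> sqrt (1 + \<delta>) * q" unfolding q_def by (intro bound(2)) simp
    then show ?thesis using norm_triangle_ineq[of "A (X - Y)" \<xi>] by linarith
  qed
  \<comment> \<open>The lower RIP bound for \<open>W - Y\<close> meets the upper one for
    \<open>X - Y\<close>; their ratio is \<open>\<kappa>\<close>.\<close>
  finally have "sqrt (1 - \<delta>) * w \<le> sqrt (1 + \<delta>) * q + norm \<xi>"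
    using bound(1)[of "W - Y"] rank_factor_update[of U V "dU - a" "dV - c"]
    unfolding w_def WY[symmetric] by linarith
  then have w: "w \<le> \<kappa> * q + \<eta>"
    using \<delta> by (simp add: \<kappa> \<eta> real_sqrt_divide field_simps)
  have q: "q \<le> 25 / 49 * e\<^sup>2 / \<sigma>"
    using tangent_residual_le[OF P Q M r r1] e7
    by (simp add: q_def Y_def \<sigma>[symmetric] e_def norm_minus_commute[of X M])
  have size: "norm (?L dU dV) \<le> e + w"
  proof -
    have "Y - M = tangent_projection P Q (X - M)"
      by (simp add: Y_def tangent_projection_diff M_tangent)
    then have "norm (Y - M) \<le> e"
      using norm_tangent_projection_le[OF P Q, of "X - M"] by (simp add: e_def norm_minus_commute)
    then show ?thesis
      using norm_triangle_ineq[of "W - Y" "Y - M"] by (simp add: W_def w_def)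
  qed
  \<comment> \<open>A preimage of the same update with controlled norm. As \<open>(dU, dV)\<close>
    has least norm among all preimages of that update, it inherits the bound.\<close>
  obtain a' c' where ac: "?L a' c' = ?L dU dV" "(norm a')\<^sup>2 + (norm c')\<^sup>2 \<le> (norm (?L dU dV))\<^sup>2 / \<mu>"
    using lift[of "?L dU dV"] by (auto simp: L_tangent)
  have "norm (dU ** transpose dV) \<le> norm dU * norm dV"
    using norm_matrix_mult_le[of dU "transpose dV"] by (simp add: norm_transpose)
  also have "\<dots> \<le> ((norm dU)\<^sup>2 + (norm dV)\<^sup>2) / 2"
    using sum_squares_bound[of "norm dU" "norm dV"] by simp
  also have "\<dots> \<le> (norm (?L dU dV))\<^sup>2 / \<mu> / 2"
    using min_norm[OF ac(1)] ac(2) by simp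
  also have "\<dots> \<le> (e + w)\<^sup>2 / \<mu> / 2"
    using size \<mu>0 by (intro divide_right_mono power_mono) auto
  finally have n: "norm (dU ** transpose dV) \<le> (e + w)\<^sup>2 / (2 * (6 / 7 * \<sigma>))"
    by (simp add: \<mu>_def)
  have eq: "(U + dU) ** transpose (V + dV) - X = (W - Y) - (X - Y) + dU ** transpose dV"
    by (simp add: W_def M_def factor_update_def transpose_add matrix_add_ldistrib matrix_add_rdistrib)
  have "norm ((U + dU) ** transpose (V + dV) - X) \<le> q + w + norm (dU ** transpose dV)"
    unfolding q_def w_def
    using norm_triangle_ineq[of "(W - Y) - (X - Y)" "dU ** transpose dV"]
      norm_triangle_ineq4[of "W - Y" "X - Y"] by (simp only: eq)
  also have "\<dots> \<le> 7 * \<kappa> ^ 3 / (4 * \<sigma>) * e\<^sup>2 + 3 * \<eta>"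
  proof (rule step_arithmetic[OF \<sigma>0 \<kappa>1 _ _ _ _ \<eta>_le q w n])
    show "e \<le> \<sigma> / (7 * \<kappa> ^ 3)" using e_le by (simp add: e_def M_def)
  qed (use \<delta> in \<open>simp_all add: e_def w_def \<eta>\<close>)
  finally show ?thesis by (simp add: e_def M_def)
qed

subsection \<open>The recursion\<close>

lemma RIP_mono:
  assumes "RIP k \<delta>' A" "\<delta>' \<le> \<delta>" "\<delta> < 1"
  shows "RIP k \<delta> A"
proof -
  have "(1 - \<delta>) * (norm X)\<^sup>2 \<le> (1 - \<delta>') * (norm X)\<^sup>2" "(1 + \<delta>') * (norm X)\<^sup>2 \<le> (1 + \<delta>) * (norm X)\<^sup>2" for X
    using assms(2) by (auto intro!: mult_right_mono)
  then show ?thesis using assms unfolding RIP_def by (meson order_trans)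
qed

lemma powr_three_halves: "x \<ge> 0 \<Longrightarrow> x powr (3 / 2) = sqrt x ^ 3"
  using powr_powr[of x "1/2" 3] by (simp add: powr_half_sqrt flip: powr_numeral)

text \<open>
  The first step has to be treated apart: the induction hypothesis \<open>e t \<le> a t + 6 \<eta>\<close> closes the
  induction only if \<open>a t \<le> \<sigma> / (4 c)\<close>, which fails for \<open>t = 0\<close>, where however \<open>e 0 \<le> a 0\<close>.
\<close>

lemma quadratic_recursion_bound:
  fixes e :: "nat \<Rightarrow> real"
  assumes pos: "\<sigma> > 0" "c > 0" "\<eta> \<ge> 0" "\<And>t. e t \<ge> 0"
    and \<eta>: "\<eta> \<le> \<sigma> / (6 * c)" and init: "e 0 \<le> \<sigma> / c"
    and step: "\<And>t. e (Suc t) \<le> c / (4 * \<sigma>) * (e t)\<^sup>2 + 3 * \<eta>"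
  shows "e t \<le> \<sigma> / (4 ^ (2 ^ t - 1) * c) + 6 * \<eta>"
proof -
  define \<gamma> where "\<gamma> = c / (4 * \<sigma>)"
  define a where "a t = \<sigma> / (4 ^ (2 ^ t - 1) * c)" for t :: nat
  have \<gamma>: "\<gamma> > 0" using pos by (simp add: \<gamma>_def)
  have a0: "a t \<ge> 0" for t using pos by (simp add: a_def)
  have a_Suc: "\<gamma> * (a t)\<^sup>2 = a (Suc t)" for t
  proof -
    \<comment> \<open>With \<open>2 ^ t = Suc m\<close> the exponents are \<open>m\<close> and
      \<open>2 * m + 1\<close>: squaring doubles \<open>m\<close>, and \<open>\<gamma>\<close>
      supplies the remaining factor 1/4.\<close>
    obtain m where m: "2 ^ t = Suc m" by (metis not0_implies_Suc power_not_zero zero_neq_numeral)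
    define z :: real where "z = 4 ^ m"
    have "z > 0" by (simp add: z_def)
    have "a t = \<sigma> / (z * c)" by (simp add: a_def m z_def)
    moreover have "a (Suc t) = \<sigma> / (4 * (z * z) * c)"
      by (simp add: a_def m z_def power_add[symmetric])
    ultimately show ?thesis
      using pos \<open>z > 0\<close> by (simp add: \<gamma>_def power2_eq_square)
  qed
  have a_le: "\<gamma> * a (Suc t) \<le> 1 / 16" for t
  proof -
    have "(1::nat) \<le> 2 ^ Suc t - 1" unfolding power_Suc using one_le_power[of "2::nat" t] by linarith
    then have "(4::real) ^ 1 \<le> 4 ^ (2 ^ Suc t - 1)" by (rule power_increasing) simp
    then have "a (Suc t) \<le> \<sigma> / (4 * c)"
      unfolding a_def using pos by (intro divide_left_mono mult_right_mono) auto
    then have "\<gamma> * a (Suc t) \<le> \<gamma> * (\<sigma> / (4 * c))" using \<gamma> by (intro mult_left_mono) auto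
    then show ?thesis using pos by (simp add: \<gamma>_def)
  qed
  have \<gamma>\<eta>: "\<gamma> * \<eta> \<le> 1 / 24"
    using mult_left_mono[OF \<eta>, of \<gamma>] \<gamma> pos by (simp add: \<gamma>_def)
  have Suc_bound: "e (Suc t) \<le> a (Suc t) + 6 * \<eta>" for t
  proof (induction t)
    case 0
    have "\<gamma> * (e 0)\<^sup>2 \<le> \<gamma> * (a 0)\<^sup>2"
      using init pos(4) \<gamma> by (intro mult_left_mono power_mono) (simp_all add: a_def)
    then show ?case using step[of 0] pos(3) by (simp add: \<gamma>_def[symmetric] a_Suc)
  next
    case (Suc t)
    have "\<gamma> * (e (Suc t))\<^sup>2 \<le> \<gamma> * (a (Suc t) + 6 * \<eta>)\<^sup>2"
      using Suc.IH pos(4) \<gamma> by (intro mult_left_mono power_mono) auto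
    also have "\<dots> = \<gamma> * (a (Suc t))\<^sup>2 + 12 * (\<gamma> * a (Suc t)) * \<eta> + 36 * (\<gamma> * \<eta>) * \<eta>"
      by (simp add: power2_eq_square algebra_simps)
    \<comment> \<open>The multiples of \<open>\<eta>\<close> add up to 3/4 + 3/2 = 9/4, which with
      the 3 from the recursion stays below 6.\<close>
    also have "\<dots> \<le> \<gamma> * (a (Suc t))\<^sup>2 + 12 * (1 / 16) * \<eta> + 36 * (1 / 24) * \<eta>"
      using a_le[of t] \<gamma>\<eta> pos(3) by (intro add_mono mult_right_mono mult_left_mono) auto
    also have "\<dots> = a (Suc (Suc t)) + 9 / 4 * \<eta>" by (simp add: a_Suc)
    finally show ?case using step[of "Suc t"] pos(3) by (simp add: \<gamma>_def[symmetric])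
  qed
  show ?thesis
  proof (cases t)
    case 0
    then show ?thesis using init pos(3) by simp
  next
    case (Suc n)
    then show ?thesis using Suc Suc_bound[of n] by (simp add: a_def)
  qed
qed

lemma double_exponential_limit:
  fixes \<sigma> c L :: real
  shows "(\<lambda>t. \<sigma> / (4 ^ (2 ^ t - 1) * c) + L) \<longlonglongrightarrow> L"
proof -
  have "(\<lambda>n. (1 / 4) ^ n) \<longlonglongrightarrow> (0::real)" by (rule LIMSEQ_power_zero) simp
  moreover have "filterlim (\<lambda>t::nat. 2 ^ t - 1 :: nat) at_top at_top"
  proof (rule filterlim_at_top_mono[OF filterlim_ident])
    show "\<forall>\<^sub>F t in sequentially. t \<le> 2 ^ t - (1::nat)"
    proof (intro always_eventually allI)
      fix t :: nat
      show "t \<le> 2 ^ t - 1" using less_exp[of t] by linarith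
    qed
  qed
  ultimately have "(\<lambda>t::nat. (1 / 4) ^ (2 ^ t - 1)) \<longlonglongrightarrow> (0::real)" by (rule filterlim_compose)
  then have "(\<lambda>t. \<sigma> / c * (1 / 4) ^ (2 ^ t - 1) + L) \<longlonglongrightarrow> \<sigma> / c * 0 + L"
    by (intro tendsto_intros)
  moreover have "\<sigma> / c * (1 / 4) ^ n + L = \<sigma> / (4 ^ n * c) + L" for n :: nat
    by (simp add: power_one_over)
  ultimately show ?thesis by simp
qed

theorem theorem3p4:
  fixes A :: "real^'n2^'n1 \<Rightarrow> real^'m"
    and b \<xi> :: "real^'m"
    and Xstar :: "real^'n2^'n1"
    and U' U :: "nat \<Rightarrow> real^'r^'n1"
    and V' V :: "nat \<Rightarrow> real^'r^'n2"
    and X :: "nat \<Rightarrow> real^'n2^'n1"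
    and \<delta> \<delta>2r c \<sigma> \<gamma> :: real
  assumes delta: "0 < \<delta>" "\<delta> < 1"
    and c: "c = 7 * (1 + \<delta>) powr (3/2) / (1 - \<delta>) powr (3/2)"
    and linear: "linear A"
    and rip: "RIP (2 * CARD('r)) \<delta>2r A" "\<delta>2r \<le> \<delta>"
    and b: "b = A Xstar + \<xi>"
    and rank: "rank Xstar = CARD('r)"
    and sigma: "\<sigma> = singular_value (CARD('r)) Xstar"
    and noise: "norm \<xi> \<le> \<sigma> * sqrt (1 - \<delta>) / (6 * c)"
    and gamma: "\<gamma> = c / (4 * \<sigma>)"
    and init: "norm (U' 0 ** transpose (V' 0) - Xstar) \<le> \<sigma> / c"
    and iterates: "gnmr_updating_iterates A b U' V' U V"
    and X: "\<And>t. X t = U t ** transpose (V t)"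
  shows "(\<forall>t. norm (X (t + 1) - Xstar)
              \<le> \<gamma> * (norm (X t - Xstar))\<^sup>2 + 3 * norm \<xi> / sqrt (1 - \<delta>))
       \<and> (\<forall>t. norm (X t - Xstar)
              \<le> \<sigma> / (4 ^ (2 ^ t - 1) * c) + 6 * norm \<xi> / sqrt (1 - \<delta>))
       \<and> (\<lambda>t. \<sigma> / (4 ^ (2 ^ t - 1) * c) + 6 * norm \<xi> / sqrt (1 - \<delta>))
            \<longlonglongrightarrow> 6 * norm \<xi> / sqrt (1 - \<delta>)"
proof -
  define \<kappa> where "\<kappa> = sqrt ((1 + \<delta>) / (1 - \<delta>))"
  define \<eta> where "\<eta> = norm \<xi> / sqrt (1 - \<delta>)"
  define e where "e t = norm (X t - Xstar)" for t
  have r1: "(1::nat) \<le> CARD('r)" by (simp add: Suc_leI)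
  have \<sigma>0: "\<sigma> > 0" unfolding sigma by (rule singular_value_rank[OF rank r1])
  have "\<kappa> > 0" using delta by (simp add: \<kappa>_def)
  \<comment> \<open>So \<open>\<sigma> / c\<close> and \<open>\<sigma> / (6 * c)\<close> are the
    thresholds of \<open>gnmr_step\<close> for the error and the noise.\<close>
  have c': "c = 7 * \<kappa> ^ 3"
    using delta by (simp add: c \<kappa>_def powr_three_halves real_sqrt_divide power_divide)
  then have c0: "c > 0" using \<open>\<kappa> > 0\<close> by simp
  have \<eta>0: "\<eta> \<ge> 0" using delta by (simp add: \<eta>_def)
  have \<eta>_le: "\<eta> \<le> \<sigma> / (6 * c)" using noise delta c0 by (simp add: \<eta>_def pos_divide_le_eq)
  have rip': "RIP (2 * CARD('r)) \<delta> A" using RIP_mono[OF rip delta(2)] .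
  have bal: "svd_balancing (U' t) (V' t) (U t) (V t)" for t
    using iterates by (simp add: gnmr_updating_iterates_def)
  \<comment> \<open>Balancing preserves the product, so the error after a step can be read off the
    unbalanced factors that the update produces.\<close>
  have X': "X t = U' t ** transpose (V' t)" for t
    unfolding X by (rule svd_balancing_product[OF bal])
  have step: "e (Suc t) \<le> c / (4 * \<sigma>) * (e t)\<^sup>2 + 3 * \<eta>" if "e t \<le> \<sigma> / c" for t
  proof -
    obtain dU dV where d: "gnmr_direction A b (U t) (V t) dU dV"
      "U' (Suc t) = U t + dU" "V' (Suc t) = V t + dV"
      using iterates unfolding gnmr_updating_iterates_def by blast
    have "norm ((U t + dU) ** transpose (V t + dV) - Xstar)
        \<le> 7 * \<kappa> ^ 3 / (4 * \<sigma>) * (norm (U t ** transpose (V t) - Xstar))\<^sup>2 + 3 * \<eta>"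
      using that \<eta>_le
      by (intro gnmr_step[OF linear rip' b rank sigma \<kappa>_def \<eta>_def bal d(1)])
        (simp_all add: c' e_def X)
    then show ?thesis by (simp add: e_def X'[of "Suc t"] d(2,3) X[of t] c')
  qed
  \<comment> \<open>The ball in which \<open>step\<close> applies is invariant: with
    \<open>y = \<sigma> / c\<close> the next error is at most \<open>y / 4 + 3 * (y / 6)\<close>,
    which is below \<open>y\<close>.\<close>
  have small: "e t \<le> \<sigma> / c" for t
  proof (induction t)
    case 0
    show ?case using init by (simp add: e_def X')
  next
    case (Suc t)
    define y where "y = \<sigma> / c"
    have "(e t)\<^sup>2 \<le> y\<^sup>2" using Suc by (intro power_mono) (simp_all add: e_def y_def)
    then have "c / (4 * \<sigma>) * (e t)\<^sup>2 \<le> c / (4 * \<sigma>) * y\<^sup>2"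
      using c0 \<sigma>0 by (intro mult_left_mono) auto
    also have "\<dots> = y / 4" using c0 \<sigma>0 by (simp add: power2_eq_square y_def)
    finally have "c / (4 * \<sigma>) * (e t)\<^sup>2 \<le> y / 4" .
    moreover have "\<eta> \<le> y / 6" using \<eta>_le by (simp add: y_def)
    moreover have "0 < y" using \<sigma>0 c0 by (simp add: y_def)
    ultimately have "e (Suc t) \<le> y" using step[OF Suc] by linarith
    then show ?case by (simp add: y_def)
  qed
  have bound: "e t \<le> \<sigma> / (4 ^ (2 ^ t - 1) * c) + 6 * \<eta>" for t
  proof (rule quadratic_recursion_bound[OF \<sigma>0 c0 \<eta>0 _ \<eta>_le small])
    show "e (Suc t) \<le> c / (4 * \<sigma>) * (e t)\<^sup>2 + 3 * \<eta>" for t by (rule step[OF small])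
  qed (simp add: e_def)
  show ?thesis
  proof (intro conjI allI)
    show "norm (X (t + 1) - Xstar) \<le> \<gamma> * (norm (X t - Xstar))\<^sup>2 + 3 * norm \<xi> / sqrt (1 - \<delta>)" for t
      using step[OF small[of t]] by (simp add: e_def \<eta>_def gamma)
    show "norm (X t - Xstar) \<le> \<sigma> / (4 ^ (2 ^ t - 1) * c) + 6 * norm \<xi> / sqrt (1 - \<delta>)" for t
      using bound[of t] by (simp add: e_def \<eta>_def)
    show "(\<lambda>t. \<sigma> / (4 ^ (2 ^ t - 1) * c) + 6 * norm \<xi> / sqrt (1 - \<delta>))
        \<longlonglongrightarrow> 6 * norm \<xi> / sqrt (1 - \<delta>)"
      by (rule double_exponential_limit)
  qed
qed

end
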